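(* Let $D=(V,A)$ be a skeletal directed acyclic graph, and let $\mho,\Omega\subseteq V$. For any acyclic reorientation $E$ of $D$, the $\equiv_{(\mho,\Omega)}$-class of $E$ is preserved by flipping any arc $(u,v)$ of $D$ that appears (reversed or not) in the transitive reduction of $E$ and is such that $\nabla_{u,v}^E\not\subseteq\mho$ or $\Delta_{u,v}^E\not\subseteq\Omega$. Moreover, the congruence $\equiv_{(\mho,\Omega)}$ is the (reflexive) transitive closure of these flips.
   Context: All directed graphs are finite and simple. A reorientation of a directed acyclic graph $D=(V,A)$ is a directed graph with the same underlying undirected graph, encoded by the set of arcs of $D$ that it reverses. $\mathcal{AR}_D$ is the poset of acyclic reorientations of $D$ ordered by inclusion of sets of reversed arcs. The transitive reduction of a directed acyclic graph is obtained by deleting all arcs whose endpoints are connected by a directed path of length at least $2$; flipping an arc of the transitive reduction of an acyclic reorientation $E$ yields an acyclic reorientation. A directed graph is a forest if its underlying undirected graph has no cycle. $D$ is vertebrate if the transitive reduction of every induced subgraph of $D$ is a forest; filled if for any directed path $\pi$ in $D$ whose endpoints are joined by an arc of $D$, all arcs joining any two vertices of $\pi$ belong to $D$; skeletal if vertebrate and filled. When $D$ is skeletal, $\mathcal{AR}_D$ is a lattice. A congruence of a lattice is an equivalence relation compatible with meets and joins. It contracts a join irreducible $J$ (covering a unique element $J_\star$) if $J_\star\equiv J$. The transitive support of an arc $(u,v)$ of $D$ is the set of vertices appearing along directed paths in $D$ from $u$ to $v$. A rope of $D$ is a quadruple $(u,v,\nabla,\Delta)$ where $(u,v)\in A$ and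 $\nabla\sqcup\Delta$ is a partition of the transitive support of $(u,v)$ minus $\{u,v\}$. For a rope $\rho=(u,v,\nabla,\Delta)$, let $I_\vee(\rho)$ be the acyclic reorientation of $D$ where an arc $(w,w')$ of $D$ is reversed if and only if $w\in\Delta\cup\{u\}$ and $w'\in\nabla\cup\{v\}$; $\rho\mapsto I_\vee(\rho)$ is a bijection from the ropes of $D$ to the join irreducibles of $\mathcal{AR}_D$. For $\mho,\Omega\subseteq V$, the coherent congruence $\equiv_{(\mho,\Omega)}$ is the unique congruence of $\mathcal{AR}_D$ whose uncontracted join irreducibles are exactly the $I_\vee(\rho)$ for the ropes $\rho=(u,v,\nabla,\Delta)$ of $D$ with $\nabla\subseteq\mho$ and $\Delta\subseteq\Omega$. For an acyclic reorientation $E$ of $D$ and an arc $(u,v)$ of $D$, $\nabla_{u,v}^E=\{w\in V : (u,w)\in D\setminus E,\ (w,v)\in D\cap E\}$ and $\Delta_{u,v}^E=\{w\in V : (u,w)\in D\cap E,\ (w,v)\in D\setminus E\}$ (membership refers to arcs). *)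

theory Defs
  imports Main "HOL-Algebra.Lattice"
begin

text \<open>
  A directed graph is given by its vertex set \<open>V\<close> and its arc relation \<open>A\<close>. Most notions
  below do not depend on isolated vertices and only take \<open>A\<close>.
\<close>

text \<open>Acyclicity of \<open>A\<close> excludes loops and pairs of opposite arcs, so the graph is simple.\<close>

definition dag :: "'a set \<Rightarrow> ('a \<times> 'a) set \<Rightarrow> bool" where
  "dag V A \<longleftrightarrow> finite V \<and> A \<subseteq> V \<times> V \<and> acyclic A"

text \<open>\<open>A O A\<^sup>+\<close> relates the endpoints of the directed walks of length at least 2.\<close>

definition transitive_reduction :: "('a \<times> 'a) set \<Rightarrow> ('a \<times> 'a) set" where
  "transitive_reduction A = A - A O A\<^sup>+"

text \<open>
  A cycle of the underlying undirected graph is listed by its (at least 3) distinct vertices.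
\<close>

definition undirected_cycle :: "('a \<times> 'a) set \<Rightarrow> 'a list \<Rightarrow> bool" where
  "undirected_cycle A xs \<longleftrightarrow>
     3 \<le> length xs \<and> distinct xs \<and>
     successively (\<lambda>x y. (x, y) \<in> A \<union> A\<inverse>) xs \<and> (last xs, hd xs) \<in> A \<union> A\<inverse>"

definition forest :: "('a \<times> 'a) set \<Rightarrow> bool" where
  "forest A \<longleftrightarrow> (\<nexists>xs. undirected_cycle A xs)"

definition vertebrate :: "'a set \<Rightarrow> ('a \<times> 'a) set \<Rightarrow> bool" where
  "vertebrate V A \<longleftrightarrow> (\<forall>X\<subseteq>V. forest (transitive_reduction (A \<inter> X \<times> X)))"

text \<open>
  A directed path is the list of its vertices; since \<open>A\<close> is acyclic in all uses, an arc joining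
  two vertices of a path points from the earlier one to the later one.
\<close>

definition filled :: "('a \<times> 'a) set \<Rightarrow> bool" where
  "filled A \<longleftrightarrow>
     (\<forall>xs. xs \<noteq> [] \<and> successively (\<lambda>x y. (x, y) \<in> A) xs \<and> (hd xs, last xs) \<in> A
        \<longrightarrow> sorted_wrt (\<lambda>x y. (x, y) \<in> A) xs)"

definition skeletal :: "'a set \<Rightarrow> ('a \<times> 'a) set \<Rightarrow> bool" where
  "skeletal V A \<longleftrightarrow> vertebrate V A \<and> filled A"

text \<open>
  A reorientation is represented by its arc relation \<open>E\<close>; the arcs of \<open>A\<close> that it reverses are
  then \<open>A - E\<close>, and those that it keeps are \<open>A \<inter> E\<close>.
\<close>

definition reorientation :: "('a \<times> 'a) set \<Rightarrow> ('a \<times> 'a) set \<Rightarrow> bool" where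
  "reorientation A E \<longleftrightarrow> E \<union> E\<inverse> = A \<union> A\<inverse> \<and> E \<inter> E\<inverse> = {}"

definition reverse_arcs :: "('a \<times> 'a) set \<Rightarrow> ('a \<times> 'a) set \<Rightarrow> ('a \<times> 'a) set" where
  "reverse_arcs A R = (A - R) \<union> R\<inverse>"

definition acyclic_reorientations :: "('a \<times> 'a) set \<Rightarrow> ('a \<times> 'a) set set" where
  "acyclic_reorientations A = {E. reorientation A E \<and> acyclic E}"

definition AR_poset :: "('a \<times> 'a) set \<Rightarrow> ('a \<times> 'a) set gorder" where
  "AR_poset A =
     \<lparr>carrier = acyclic_reorientations A, eq = (=), le = (\<lambda>E F. A - E \<subseteq> A - F)\<rparr>"

definition covers :: "('b, 'm) gorder_scheme \<Rightarrow> 'b \<Rightarrow> 'b \<Rightarrow> bool" where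
  "covers L y x \<longleftrightarrow>
     x \<in> carrier L \<and> y \<in> carrier L \<and> x \<sqsubset>\<^bsub>L\<^esub> y \<and>
     (\<nexists>z. z \<in> carrier L \<and> x \<sqsubset>\<^bsub>L\<^esub> z \<and> z \<sqsubset>\<^bsub>L\<^esub> y)"

definition join_irreducible :: "('b, 'm) gorder_scheme \<Rightarrow> 'b \<Rightarrow> bool" where
  "join_irreducible L J \<longleftrightarrow> (\<exists>!x. covers L J x)"

definition lower_cover :: "('b, 'm) gorder_scheme \<Rightarrow> 'b \<Rightarrow> 'b" where
  "lower_cover L J = (THE x. covers L J x)"

definition lattice_congruence :: "('b, 'm) gorder_scheme \<Rightarrow> ('b \<times> 'b) set \<Rightarrow> bool" where
  "lattice_congruence L \<theta> \<longleftrightarrow>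
     equiv (carrier L) \<theta> \<and>
     (\<forall>(x, x')\<in>\<theta>. \<forall>(y, y')\<in>\<theta>.
        (x \<squnion>\<^bsub>L\<^esub> y, x' \<squnion>\<^bsub>L\<^esub> y') \<in> \<theta> \<and> (x \<sqinter>\<^bsub>L\<^esub> y, x' \<sqinter>\<^bsub>L\<^esub> y') \<in> \<theta>)"

definition uncontracted :: "('b, 'm) gorder_scheme \<Rightarrow> ('b \<times> 'b) set \<Rightarrow> 'b set" where
  "uncontracted L \<theta> = {J. join_irreducible L J \<and> (lower_cover L J, J) \<notin> \<theta>}"

text \<open>In an acyclic graph, every directed walk is a path.\<close>

definition transitive_support :: "('a \<times> 'a) set \<Rightarrow> 'a \<Rightarrow> 'a \<Rightarrow> 'a set" where
  "transitive_support A u v = {w. (u, w) \<in> A\<^sup>* \<and> (w, v) \<in> A\<^sup>*}"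

type_synonym 'a rope = "'a \<times> 'a \<times> 'a set \<times> 'a set"

definition ropes :: "('a \<times> 'a) set \<Rightarrow> 'a rope set" where
  "ropes A =
     {(u, v, Nabla, \<Delta>). (u, v) \<in> A \<and> Nabla \<inter> \<Delta> = {} \<and> Nabla \<union> \<Delta> = transitive_support A u v - {u, v}}"

fun I_join :: "('a \<times> 'a) set \<Rightarrow> 'a rope \<Rightarrow> ('a \<times> 'a) set" where
  "I_join A (u, v, Nabla, \<Delta>) =
     reverse_arcs A {(w, w') \<in> A. w \<in> \<Delta> \<union> {u} \<and> w' \<in> Nabla \<union> {v}}"

definition coherent_congruence ::
  "('a \<times> 'a) set \<Rightarrow> 'a set \<Rightarrow> 'a set \<Rightarrow> (('a \<times> 'a) set \<times> ('a \<times> 'a) set) set" where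
  "coherent_congruence A Mho \<Omega> =
     (THE \<theta>. lattice_congruence (AR_poset A) \<theta> \<and>
        uncontracted (AR_poset A) \<theta> =
          I_join A ` {(u, v, Nabla, \<Delta>) \<in> ropes A. Nabla \<subseteq> Mho \<and> \<Delta> \<subseteq> \<Omega>})"

definition nabla_set :: "('a \<times> 'a) set \<Rightarrow> ('a \<times> 'a) set \<Rightarrow> 'a \<Rightarrow> 'a \<Rightarrow> 'a set" where
  "nabla_set A E u v = {w. (u, w) \<in> A - E \<and> (w, v) \<in> A \<inter> E}"

definition delta_set :: "('a \<times> 'a) set \<Rightarrow> ('a \<times> 'a) set \<Rightarrow> 'a \<Rightarrow> 'a \<Rightarrow> 'a set" where
  "delta_set A E u v = {w. (u, w) \<in> A \<inter> E \<and> (w, v) \<in> A - E}"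

text \<open>The symmetric difference replaces whichever of \<open>(u, v)\<close>, \<open>(v, u)\<close> is in \<open>E\<close> by the other.\<close>

definition flip :: "('a \<times> 'a) set \<Rightarrow> 'a \<Rightarrow> 'a \<Rightarrow> ('a \<times> 'a) set" where
  "flip E u v = (E - {(u, v), (v, u)}) \<union> ({(u, v), (v, u)} - E)"

definition coherent_flippable ::
  "('a \<times> 'a) set \<Rightarrow> 'a set \<Rightarrow> 'a set \<Rightarrow> ('a \<times> 'a) set \<Rightarrow> 'a \<Rightarrow> 'a \<Rightarrow> bool" where
  "coherent_flippable A Mho \<Omega> E u v \<longleftrightarrow>
     (u, v) \<in> A \<and>
     ((u, v) \<in> transitive_reduction E \<or> (v, u) \<in> transitive_reduction E) \<and>
     (\<not> nabla_set A E u v \<subseteq> Mho \<or> \<not> delta_set A E u v \<subseteq> \<Omega>)"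

definition coherent_flips ::
  "('a \<times> 'a) set \<Rightarrow> 'a set \<Rightarrow> 'a set \<Rightarrow> (('a \<times> 'a) set \<times> ('a \<times> 'a) set) set" where
  "coherent_flips A Mho \<Omega> =
     {(E, flip E u v) | E u v. E \<in> acyclic_reorientations A \<and> coherent_flippable A Mho \<Omega> E u v}"

end

theory Submission
  imports Defs
begin

text \<open>
  In a skeletal graph the support of an arc is a linearly ordered clique, and a reorientation is
  acyclic iff its set of reversed arcs is biclosed: on every triangle \<open>u \<rightarrow> w \<rightarrow> v\<close>, \<open>u \<rightarrow> v\<close>, both this
  set and its complement are closed under composition. Joins are then restricted transitive
  closures.

  Fix a vertex \<open>w\<close> and remove from a biclosed set \<open>R\<close> all arcs \<open>(u, v)\<close> such that \<open>(u, w)\<close> is in \<open>R\<close>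
  and \<open>(w, v)\<close> is an arc outside \<open>R\<close>. This projection and the dual one, which adds these arcs,
  preserve biclosedness and inclusion, so their common kernel is a lattice congruence. It
  contracts exactly the ropes with \<open>w\<close> in \<open>Nabla\<close>, and descending from \<open>R\<close> to its projection by
  single flips shows that it is generated by the flips at \<open>(u, v)\<close> with \<open>w\<close> in the nabla set.
  The same works for \<open>\<Delta>\<close> by reversing all arcs. The coherent congruence is the join of these
  congruences over the vertices outside \<open>Mho\<close> and \<open>\<Omega>\<close>, that is, the transitive closure of their
  union, because a congruence of a finite lattice is determined by its uncontracted join
  irreducibles and a join of congruences contracts a join irreducible iff one of them does.
\<close>

section \<open>Congruences of finite lattices\<close>

context lattice
begin

lemma lattice_congruenceI:
  assumes "equiv (carrier L) \<theta>"
    and join: "\<And>x x' y. (x, x') \<in> \<theta> \<Longrightarrow> y \<in> carrier L \<Longrightarrow> (x \<squnion> y, x' \<squnion> y) \<in> \<theta>"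
    and meet: "\<And>x x' y. (x, x') \<in> \<theta> \<Longrightarrow> y \<in> carrier L \<Longrightarrow> (x \<sqinter> y, x' \<sqinter> y) \<in> \<theta>"
  shows "lattice_congruence L \<theta>"
proof -
  have carr: "x \<in> carrier L" "y \<in> carrier L" if "(x, y) \<in> \<theta>" for x y
    using that assms(1) by (auto simp: equiv_def)
  have tr: "(x, z) \<in> \<theta>" if "(x, y) \<in> \<theta>" "(y, z) \<in> \<theta>" for x y z
    using that assms(1) by (auto simp: equiv_def elim: transE)
  have "(x \<squnion> y, x' \<squnion> y') \<in> \<theta> \<and> (x \<sqinter> y, x' \<sqinter> y') \<in> \<theta>"
    if "(x, x') \<in> \<theta>" "(y, y') \<in> \<theta>" for x x' y y'
  proof
    show "(x \<squnion> y, x' \<squnion> y') \<in> \<theta>"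
      using tr[OF join[OF that(1) carr(1)[OF that(2)]]] join[OF that(2) carr(2)[OF that(1)]]
      by (simp add: join_comm)
    show "(x \<sqinter> y, x' \<sqinter> y') \<in> \<theta>"
      using tr[OF meet[OF that(1) carr(1)[OF that(2)]]] meet[OF that(2) carr(2)[OF that(1)]]
      by (simp add: meet_comm)
  qed
  with assms(1) show ?thesis by (auto simp: lattice_congruence_def)
qed

text \<open>\<open>p\<close> and \<open>q\<close> send an element to the bottom and to the top of
  its class. Joins are controlled from above by \<open>q (x' \<squnion> y)\<close>, meets from below
  by \<open>p (x \<sqinter> y)\<close>.\<close>

lemma kernel_congruence:
  assumes p: "\<And>x. x \<in> carrier L \<Longrightarrow> p x \<in> carrier L" and q: "\<And>x. x \<in> carrier L \<Longrightarrow> q x \<in> carrier L"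
    and p_le: "\<And>x. x \<in> carrier L \<Longrightarrow> p x \<sqsubseteq> x" and le_q: "\<And>x. x \<in> carrier L \<Longrightarrow> x \<sqsubseteq> q x"
    and p_mono: "\<And>x y. x \<in> carrier L \<Longrightarrow> y \<in> carrier L \<Longrightarrow> x \<sqsubseteq> y \<Longrightarrow> p x \<sqsubseteq> p y"
    and q_mono: "\<And>x y. x \<in> carrier L \<Longrightarrow> y \<in> carrier L \<Longrightarrow> x \<sqsubseteq> y \<Longrightarrow> q x \<sqsubseteq> q y"
    and pq: "\<And>x. x \<in> carrier L \<Longrightarrow> p (q x) = p x" and qp: "\<And>x. x \<in> carrier L \<Longrightarrow> q (p x) = q x"
  shows "lattice_congruence L {(x, y) \<in> carrier L \<times> carrier L. p x = p y}"
proof -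
  have join: "p (x \<squnion> y) \<sqsubseteq> p (x' \<squnion> y)"
    if c: "x \<in> carrier L" "x' \<in> carrier L" "y \<in> carrier L" and eq: "p x = p x'" for x x' y
  proof -
    have "q x = q x'" by (metis c(1,2) eq qp)
    then have "x \<sqsubseteq> q (x' \<squnion> y)"
      using le_trans[of x "q x'" "q (x' \<squnion> y)"] le_q[of x] q_mono[of x' "x' \<squnion> y"] c q by (simp add: join_left)
    moreover have "y \<sqsubseteq> q (x' \<squnion> y)"
      using le_trans[of y "x' \<squnion> y" "q (x' \<squnion> y)"] le_q q c by (simp add: join_right)
    ultimately have "x \<squnion> y \<sqsubseteq> q (x' \<squnion> y)" using c q by (simp add: join_le)
    then show ?thesis using p_mono[of "x \<squnion> y" "q (x' \<squnion> y)"] c q pq by simp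
  qed
  have meet: "p (x \<sqinter> y) \<sqsubseteq> p (x' \<sqinter> y)"
    if c: "x \<in> carrier L" "x' \<in> carrier L" "y \<in> carrier L" and eq: "p x = p x'" for x x' y
  proof -
    have "p (x \<sqinter> y) \<sqsubseteq> p x" using c p_mono by (simp add: meet_left)
    then have "p (x \<sqinter> y) \<sqsubseteq> x'" using le_trans[OF _ p_le[of x']] c eq p by simp
    moreover have "p (x \<sqinter> y) \<sqsubseteq> y"
      using le_trans[OF p_le meet_right] c p by simp
    ultimately have "p (x \<sqinter> y) \<sqsubseteq> x' \<sqinter> y" using c p by (simp add: meet_le)
    then have "p (p (x \<sqinter> y)) \<sqsubseteq> p (x' \<sqinter> y)" using p_mono c p by simp
    \<comment> \<open>Idempotence comes from the two mixed laws:
      \<open>p (p z) = p (q (p z)) = p (q z) = p z\<close>.\<close>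
    moreover have "p (p z) = p z" if "z \<in> carrier L" for z
      by (metis that p pq qp)
    ultimately show ?thesis using c by simp
  qed
  show ?thesis
  proof (rule lattice_congruenceI)
    show "equiv (carrier L) {(x, y) \<in> carrier L \<times> carrier L. p x = p y}"
      by (auto simp: equiv_def refl_on_def sym_def trans_def)
  next
    fix x x' y assume "(x, x') \<in> {(x, y) \<in> carrier L \<times> carrier L. p x = p y}" "y \<in> carrier L"
    then show "(x \<squnion> y, x' \<squnion> y) \<in> {(x, y) \<in> carrier L \<times> carrier L. p x = p y}"
      using join[of x x' y] join[of x' x y] p by (auto intro: le_antisym)
  next
    fix x x' y assume "(x, x') \<in> {(x, y) \<in> carrier L \<times> carrier L. p x = p y}" "y \<in> carrier L"
    then show "(x \<sqinter> y, x' \<sqinter> y) \<in> {(x, y) \<in> carrier L \<times> carrier L. p x = p y}"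
      using meet[of x x' y] meet[of x' x y] p by (auto intro: le_antisym)
  qed
qed

lemma
  assumes "lattice_congruence L \<theta>"
  shows congruence_refl: "x \<in> carrier L \<Longrightarrow> (x, x) \<in> \<theta>"
    and congruence_sym: "(x, y) \<in> \<theta> \<Longrightarrow> (y, x) \<in> \<theta>"
    and congruence_trans: "(x, y) \<in> \<theta> \<Longrightarrow> (y, z) \<in> \<theta> \<Longrightarrow> (x, z) \<in> \<theta>"
    and congruence_left: "(x, y) \<in> \<theta> \<Longrightarrow> x \<in> carrier L"
    and congruence_right: "(x, y) \<in> \<theta> \<Longrightarrow> y \<in> carrier L"
    and congruence_join: "(x, x') \<in> \<theta> \<Longrightarrow> (y, y') \<in> \<theta> \<Longrightarrow> (x \<squnion> y, x' \<squnion> y') \<in> \<theta>"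
    and congruence_meet: "(x, x') \<in> \<theta> \<Longrightarrow> (y, y') \<in> \<theta> \<Longrightarrow> (x \<sqinter> y, x' \<sqinter> y') \<in> \<theta>"
proof -
  have eq: "equiv (carrier L) \<theta>" using assms by (simp add: lattice_congruence_def)
  then show "x \<in> carrier L \<Longrightarrow> (x, x) \<in> \<theta>" using eq by (meson equivE refl_onD)
  show "(x, y) \<in> \<theta> \<Longrightarrow> (y, x) \<in> \<theta>" using eq by (meson equivE symD)
  show "(x, y) \<in> \<theta> \<Longrightarrow> (y, z) \<in> \<theta> \<Longrightarrow> (x, z) \<in> \<theta>" using eq by (meson equivE transD)
  have sub: "\<theta> \<subseteq> carrier L \<times> carrier L" using eq by (simp add: equiv_def)
  then show "(x, y) \<in> \<theta> \<Longrightarrow> x \<in> carrier L" "(x, y) \<in> \<theta> \<Longrightarrow> y \<in> carrier L" by blast+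
  show "(x \<squnion> y, x' \<squnion> y') \<in> \<theta>" "(x \<sqinter> y, x' \<sqinter> y') \<in> \<theta>" if "(x, x') \<in> \<theta>" "(y, y') \<in> \<theta>"
    using assms that by (auto simp: lattice_congruence_def)
qed

lemma meet_absorb: "x \<in> carrier L \<Longrightarrow> y \<in> carrier L \<Longrightarrow> x \<sqsubseteq> y \<Longrightarrow> x \<sqinter> y = x"
  by (metis le_iff_join)

lemma join_absorb: "x \<in> carrier L \<Longrightarrow> y \<in> carrier L \<Longrightarrow> x \<sqsubseteq> y \<Longrightarrow> x \<squnion> y = y"
  by (metis le_iff_meet)

lemma congruence_convex:
  assumes \<theta>: "lattice_congruence L \<theta>" and ac: "(a, c) \<in> \<theta>" and b: "b \<in> carrier L" "a \<sqsubseteq> b" "b \<sqsubseteq> c"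
  shows "(a, b) \<in> \<theta>" "(b, c) \<in> \<theta>"
proof -
  have c: "a \<in> carrier L" "c \<in> carrier L"
    using congruence_left[OF \<theta> ac] congruence_right[OF \<theta> ac] .
  have "(a \<sqinter> b, c \<sqinter> b) \<in> \<theta>" using congruence_meet[OF \<theta> ac congruence_refl[OF \<theta> b(1)]] .
  then show ab: "(a, b) \<in> \<theta>" using b c meet_absorb[of a b] meet_absorb[of b c] by (simp add: meet_comm)
  show "(b, c) \<in> \<theta>" using congruence_trans[OF \<theta> congruence_sym[OF \<theta> ab] ac] .
qed

section \<open>Lower covers and join irreducibles of a finite lattice\<close>

lemma exists_cover:
  assumes fin: "finite (carrier L)" and "x \<in> carrier L" "y \<in> carrier L" "x \<sqsubset> y"
  shows "\<exists>z. covers L y z \<and> x \<sqsubseteq> z"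
  using assms(2-)
proof (induction "card {z \<in> carrier L. x \<sqsubset> z \<and> z \<sqsubset> y}" arbitrary: x rule: less_induct)
  case less
  show ?case
  proof (cases "covers L y x")
    case True then show ?thesis using less.prems by blast
  next
    case False
    then obtain z where z: "z \<in> carrier L" "x \<sqsubset> z" "z \<sqsubset> y"
      using less.prems unfolding covers_def by blast
    have "{t \<in> carrier L. z \<sqsubset> t \<and> t \<sqsubset> y} \<subset> {t \<in> carrier L. x \<sqsubset> t \<and> t \<sqsubset> y}"
      using z less.prems lless_trans[of x z] by (blast dest: weak_lless_imp_not_eq[of L])
    then have "card {t \<in> carrier L. z \<sqsubset> t \<and> t \<sqsubset> y} < card {t \<in> carrier L. x \<sqsubset> t \<and> t \<sqsubset> y}"
      using fin by (intro psubset_card_mono) auto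
    from less.hyps[OF this z(1) less.prems(2) z(3)] obtain c where "covers L y c" "z \<sqsubseteq> c" by blast
    moreover from this have "x \<sqsubseteq> c"
      using z less.prems le_trans[of x z c] by (simp add: covers_def lless_eq)
    ultimately show ?thesis by blast
  qed
qed

lemma lower_cover_eqI:
  assumes "covers L J x" "join_irreducible L J"
  shows "lower_cover L J = x"
  using assms by (auto simp: lower_cover_def join_irreducible_def)

lemma join_irreducible_covers:
  "join_irreducible L J \<Longrightarrow> covers L J (lower_cover L J)"
  unfolding join_irreducible_def lower_cover_def by (rule theI')

lemma join_irreducible_lt:
  assumes "finite (carrier L)" "join_irreducible L J" "x \<in> carrier L" "x \<sqsubset> J"
  shows "x \<sqsubseteq> lower_cover L J"
proof -
  have "J \<in> carrier L" using join_irreducible_covers[OF assms(2)] by (simp add: covers_def)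
  with exists_cover[OF assms(1,3) _ assms(4)] obtain z where "covers L J z" "x \<sqsubseteq> z" by blast
  then show ?thesis using lower_cover_eqI[OF _ assms(2)] by simp
qed

lemma join_irreducibleI:
  assumes "x \<in> carrier L" "J \<in> carrier L" "x \<sqsubset> J"
    and below: "\<And>z. z \<in> carrier L \<Longrightarrow> z \<sqsubset> J \<Longrightarrow> z \<sqsubseteq> x"
  shows "join_irreducible L J" "lower_cover L J = x"
proof -
  have c: "covers L J x"
    using assms unfolding covers_def lless_eq by (metis le_antisym)
  moreover have "y = x" if "covers L J y" for y
    using that assms unfolding covers_def by (metis lless_eq)
  ultimately show ji: "join_irreducible L J" unfolding join_irreducible_def by blast
  show "lower_cover L J = x" by (rule lower_cover_eqI[OF c ji])
qed

text \<open>
  If \<open>(x, y)\<close> with \<open>x \<sqsubset> y\<close> were in \<open>\<theta> - \<theta>'\<close>, then a minimal \<open>J \<sqsubseteq> y\<close> that \<open>\<theta>'\<close> does not identify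
  with \<open>J \<sqinter> x\<close> would be a join irreducible contracted by \<open>\<theta>\<close> but not by \<open>\<theta>'\<close>.
\<close>

lemma congruence_subset_of_uncontracted:
  assumes fin: "finite (carrier L)"
    and \<theta>: "lattice_congruence L \<theta>" and \<theta>': "lattice_congruence L \<theta>'"
    and sub: "uncontracted L \<theta>' \<subseteq> uncontracted L \<theta>"
  shows "\<theta> \<subseteq> \<theta>'"
proof -
  have le: "(x, y) \<in> \<theta>'" if xy: "(x, y) \<in> \<theta>" and "x \<sqsubseteq> y" for x y
  proof (rule ccontr)
    assume nxy: "(x, y) \<notin> \<theta>'"
    have c: "x \<in> carrier L" "y \<in> carrier L"
      using congruence_left[OF \<theta> xy] congruence_right[OF \<theta> xy] .
    define B where "B J \<longleftrightarrow> J \<in> carrier L \<and> J \<sqsubseteq> y \<and> (J \<sqinter> x, J) \<notin> \<theta>'" for J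
    have "B y" using c nxy meet_absorb[of x y] \<open>x \<sqsubseteq> y\<close> by (simp add: B_def meet_comm[of L y])
    let ?r = "{(a, b). a \<in> carrier L \<and> b \<in> carrier L \<and> a \<sqsubset> b}"
    have wf: "wf ?r"
    proof (rule finite_acyclic_wf)
      show "finite ?r"
        by (rule finite_subset[of _ "carrier L \<times> carrier L"]) (use fin in auto)
      have "trans ?r" using lless_trans by (intro transI) blast
      moreover have "(a, a) \<notin> ?r" for a by (simp add: lless_eq)
      ultimately show "acyclic ?r" by (simp only: acyclic_def trancl_id not_False_eq_True simp_thms)
    qed
    obtain J where J: "B J" and min: "\<And>z. (z, J) \<in> ?r \<Longrightarrow> \<not> B z"
      using wfE_min[OF wf, of y "Collect B"] \<open>B y\<close> unfolding mem_Collect_eq by blast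
    have Jc: "J \<in> carrier L" "J \<sqsubseteq> y" "(J \<sqinter> x, J) \<notin> \<theta>'" using J by (auto simp: B_def)
    have Jx: "J \<sqinter> x \<in> carrier L" "J \<sqinter> x \<sqsubseteq> J" "J \<sqinter> x \<sqsubset> J"
      using Jc c congruence_refl[OF \<theta>' Jc(1)] by (auto simp: meet_left lless_eq)
    have below: "(z \<sqinter> x, z) \<in> \<theta>'" if "z \<in> carrier L" "z \<sqsubset> J" for z
    proof -
      have "z \<sqsubseteq> y" using that Jc c le_trans[of z J y] by (simp add: lless_eq)
      then show ?thesis using min[of z] that Jc(1) unfolding B_def by blast
    qed
    \<comment> \<open>Two distinct lower covers would join to \<open>J\<close>. By minimality each
      is identified with its meet with \<open>x\<close>, so \<open>J\<close> would be identified
      with an element below \<open>J \<sqinter> x\<close>, and by convexity with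
      \<open>J \<sqinter> x\<close> itself.\<close>
    have "a = b" if a: "covers L J a" and b: "covers L J b" for a b
    proof (rule ccontr)
      assume "a \<noteq> b"
      have ab: "a \<in> carrier L" "b \<in> carrier L" "a \<sqsubset> J" "b \<sqsubset> J"
        and na: "\<And>z. z \<in> carrier L \<Longrightarrow> a \<sqsubset> z \<Longrightarrow> \<not> z \<sqsubset> J"
        and nb: "\<And>z. z \<in> carrier L \<Longrightarrow> b \<sqsubset> z \<Longrightarrow> \<not> z \<sqsubset> J"
        using a b by (auto simp: covers_def)
      have "a \<squnion> b \<sqsubseteq> J" using ab Jc by (auto intro: join_le simp: lless_eq)
      moreover have "a \<squnion> b \<noteq> a \<or> a \<squnion> b \<noteq> b" using \<open>a \<noteq> b\<close> by auto
      ultimately have "a \<squnion> b = J"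
        using na[OF join_closed[OF ab(1,2)]] nb[OF join_closed[OF ab(1,2)]]
          join_left[OF ab(1,2)] join_right[OF ab(1,2)] unfolding lless_eq by metis
      then have "((a \<sqinter> x) \<squnion> (b \<sqinter> x), J) \<in> \<theta>'"
        using congruence_join[OF \<theta>' below[OF ab(1,3)] below[OF ab(2,4)]] by simp
      moreover have "a \<sqinter> x \<sqsubseteq> J \<sqinter> x" "b \<sqinter> x \<sqsubseteq> J \<sqinter> x"
        using ab Jc c le_trans[OF meet_left[of a x], of J] le_trans[OF meet_left[of b x], of J]
        by (auto intro!: meet_le meet_right simp: lless_eq)
      then have "(a \<sqinter> x) \<squnion> (b \<sqinter> x) \<sqsubseteq> J \<sqinter> x" using ab c Jc by (auto intro: join_le)
      ultimately show False using congruence_convex(2)[OF \<theta>' _ Jx(1) _ Jx(2)] Jc by blast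
    qed
    with exists_cover[OF fin Jx(1) Jc(1) Jx(3)] have ji: "join_irreducible L J"
      by (auto simp: join_irreducible_def)
    let ?K = "lower_cover L J"
    have K: "?K \<in> carrier L" "?K \<sqsubset> J" using join_irreducible_covers[OF ji] by (auto simp: covers_def)
    have JK: "J \<sqinter> x \<sqsubseteq> ?K" using join_irreducible_lt[OF fin ji Jx(1,3)] .
    have KJ: "?K \<sqsubseteq> J" using K by (simp add: lless_eq)
    \<comment> \<open>By minimality, \<open>\<theta>'\<close> identifies the lower cover with its
      meet with \<open>x\<close>. This meet is still \<open>J \<sqinter> x\<close>, so
      \<open>\<theta>'\<close> cannot contract \<open>J\<close>.\<close>
    have "?K \<sqinter> x = J \<sqinter> x"
    proof (rule le_antisym)
      show "?K \<sqinter> x \<sqsubseteq> J \<sqinter> x"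
        using le_trans[OF meet_left[of ?K x] KJ] c K Jc by (auto intro!: meet_le meet_right)
      show "J \<sqinter> x \<sqsubseteq> ?K \<sqinter> x" using JK c K Jc by (auto intro!: meet_le meet_right)
    qed (use K c Jc in auto)
    with below[OF K] have "(J \<sqinter> x, ?K) \<in> \<theta>'" by simp
    then have "(?K, J) \<notin> \<theta>'" using Jc(3) congruence_trans[OF \<theta>'] by blast
    then have "J \<in> uncontracted L \<theta>" using ji sub by (auto simp: uncontracted_def)
    \<comment> \<open>Conversely \<open>\<theta>\<close> identifies \<open>J \<sqinter> x\<close>
      with \<open>J\<close>, and the lower cover lies between them.\<close>
    moreover have "(J \<sqinter> x, J \<sqinter> y) \<in> \<theta>" using congruence_meet[OF \<theta> congruence_refl[OF \<theta> Jc(1)] xy] .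
    then have "(?K, J) \<in> \<theta>"
      using congruence_convex(2)[OF \<theta> _ K(1) JK KJ] meet_absorb[OF Jc(1) c(2) Jc(2)] by simp
    ultimately show False by (simp add: uncontracted_def)
  qed
  show ?thesis
  proof (rule subrelI)
    fix x y assume xy: "(x, y) \<in> \<theta>"
    have c: "x \<in> carrier L" "y \<in> carrier L"
      using congruence_left[OF \<theta> xy] congruence_right[OF \<theta> xy] .
    \<comment> \<open>An arbitrary pair reduces to two comparable pairs with smaller member
      \<open>x \<sqinter> y\<close>.\<close>
    have "x \<sqinter> x = x" "y \<sqinter> y = y" using c by (simp_all add: meet_absorb)
    then have "(x \<sqinter> y, x) \<in> \<theta>" "(x \<sqinter> y, y) \<in> \<theta>"
      using congruence_meet[OF \<theta> congruence_refl[OF \<theta> c(1)] congruence_sym[OF \<theta> xy]]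
        congruence_meet[OF \<theta> xy congruence_refl[OF \<theta> c(2)]] by auto
    then have "(x \<sqinter> y, x) \<in> \<theta>'" "(x \<sqinter> y, y) \<in> \<theta>'" using le c by (auto simp: meet_left meet_right)
    then show "(x, y) \<in> \<theta>'" using congruence_sym[OF \<theta>'] congruence_trans[OF \<theta>'] by blast
  qed
qed

lemma congruence_eq_of_uncontracted:
  assumes "finite (carrier L)" "lattice_congruence L \<theta>" "lattice_congruence L \<theta>'"
    and "uncontracted L \<theta> = uncontracted L \<theta>'"
  shows "\<theta> = \<theta>'"
  using congruence_subset_of_uncontracted[of \<theta> \<theta>'] congruence_subset_of_uncontracted[of \<theta>' \<theta>] assms
  by blast

text \<open>Each link of a chain can be joined or met with \<open>y\<close> inside its own
  congruence. \<open>Id_on\<close> supplies reflexivity, also when \<open>\<Theta>\<close> is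
  empty.\<close>

lemma congruence_Union:
  assumes \<Theta>: "\<And>\<theta>. \<theta> \<in> \<Theta> \<Longrightarrow> lattice_congruence L \<theta>"
  shows "lattice_congruence L (Id_on (carrier L) \<union> (\<Union>\<Theta>)\<^sup>+)" (is "lattice_congruence L ?T")
proof (rule lattice_congruenceI)
  have carr: "(\<Union>\<Theta>)\<^sup>+ \<subseteq> carrier L \<times> carrier L"
  proof (rule trancl_subset_Sigma, rule subrelI)
    fix x y assume "(x, y) \<in> \<Union>\<Theta>"
    then obtain \<theta> where "\<theta> \<in> \<Theta>" "(x, y) \<in> \<theta>" by blast
    then show "(x, y) \<in> carrier L \<times> carrier L"
      using congruence_left[OF \<Theta>] congruence_right[OF \<Theta>] by simp
  qed
  have "sym (\<Union>\<Theta>)"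
  proof (rule symI)
    fix x y assume "(x, y) \<in> \<Union>\<Theta>"
    then obtain \<theta> where "\<theta> \<in> \<Theta>" "(x, y) \<in> \<theta>" by blast
    then show "(y, x) \<in> \<Union>\<Theta>" using congruence_sym[OF \<Theta>] by blast
  qed
  then have "sym ?T" by (intro sym_Un sym_Id_on sym_trancl)
  moreover have "trans ?T"
    unfolding trans_def by (auto dest: trancl_trans)
  ultimately show "equiv (carrier L) ?T" using carr by (auto simp: equiv_def refl_on_def)
next
  fix x x' y assume "(x, x') \<in> ?T" and y: "y \<in> carrier L"
  then consider "x = x'" "x \<in> carrier L" | "(x, x') \<in> (\<Union>\<Theta>)\<^sup>+" by auto
  then show "(x \<squnion> y, x' \<squnion> y) \<in> ?T"
  proof cases
    case 2
    then have "(x \<squnion> y, x' \<squnion> y) \<in> (\<Union>\<Theta>)\<^sup>+"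
    proof (induction rule: trancl_induct)
      case (base z)
      then show ?case using congruence_join[OF \<Theta> _ congruence_refl[OF \<Theta> y]] by blast
    next
      case (step z t)
      then obtain \<theta> where "\<theta> \<in> \<Theta>" "(z, t) \<in> \<theta>" by blast
      then have "(z \<squnion> y, t \<squnion> y) \<in> \<Union>\<Theta>" using congruence_join[OF \<Theta> _ congruence_refl[OF \<Theta> y]] by blast
      then show ?case using step.IH by (rule trancl_into_trancl[rotated])
    qed
    then show ?thesis ..
  qed (use y in auto)
next
  fix x x' y assume "(x, x') \<in> ?T" and y: "y \<in> carrier L"
  then consider "x = x'" "x \<in> carrier L" | "(x, x') \<in> (\<Union>\<Theta>)\<^sup>+" by auto
  then show "(x \<sqinter> y, x' \<sqinter> y) \<in> ?T"
  proof cases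
    case 2
    then have "(x \<sqinter> y, x' \<sqinter> y) \<in> (\<Union>\<Theta>)\<^sup>+"
    proof (induction rule: trancl_induct)
      case (base z)
      then show ?case using congruence_meet[OF \<Theta> _ congruence_refl[OF \<Theta> y]] by blast
    next
      case (step z t)
      then obtain \<theta> where "\<theta> \<in> \<Theta>" "(z, t) \<in> \<theta>" by blast
      then have "(z \<sqinter> y, t \<sqinter> y) \<in> \<Union>\<Theta>" using congruence_meet[OF \<Theta> _ congruence_refl[OF \<Theta> y]] by blast
      then show ?case using step.IH by (rule trancl_into_trancl[rotated])
    qed
    then show ?thesis ..
  qed (use y in auto)
qed

text \<open>
  The map \<open>z \<mapsto> (z \<squnion> x) \<sqinter> J\<close> sends a chain from \<open>x\<close> to \<open>J\<close> into \<open>{x, J}\<close>, so one of its steps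
  already identifies \<open>x\<close> with \<open>J\<close>.
\<close>

lemma covers_Union_congruence:
  assumes \<Theta>: "\<And>\<theta>. \<theta> \<in> \<Theta> \<Longrightarrow> lattice_congruence L \<theta>" and cov: "covers L J x"
  shows "(x, J) \<in> Id_on (carrier L) \<union> (\<Union>\<Theta>)\<^sup>+ \<longleftrightarrow> (\<exists>\<theta>\<in>\<Theta>. (x, J) \<in> \<theta>)"
proof
  have c: "x \<in> carrier L" "J \<in> carrier L" "x \<sqsubset> J" "x \<sqsubseteq> J"
    and nb: "\<And>z. z \<in> carrier L \<Longrightarrow> x \<sqsubset> z \<Longrightarrow> \<not> z \<sqsubset> J"
    using cov by (auto simp: covers_def lless_eq)
  assume "(x, J) \<in> Id_on (carrier L) \<union> (\<Union>\<Theta>)\<^sup>+"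
  then have xJ: "(x, J) \<in> (\<Union>\<Theta>)\<^sup>+" using c by (auto simp: lless_eq)
  define f where "f z = (z \<squnion> x) \<sqinter> J" for z
  have f: "f z = x \<or> f z = J" if "z \<in> carrier L" for z
    using nb[of "f z"] c that meet_right[of "z \<squnion> x" J] meet_le[of x "z \<squnion> x" J] join_right[of z x]
    by (auto simp: f_def lless_eq)
  have fJ: "f J = J" using c join_absorb[of x J] meet_absorb[of J J] by (simp add: f_def join_comm[of L J])
  have fx: "f x = x" using c by (simp add: f_def join_absorb meet_absorb)
  \<comment> \<open>The value of \<open>f\<close> can leave \<open>x\<close> only by jumping to
    \<open>J\<close>, and the congruence of the link where it jumps then contains
    \<open>(x, J)\<close>.\<close>
  have "f z = x \<or> (\<exists>\<theta>\<in>\<Theta>. (x, J) \<in> \<theta>)" if "(x, z) \<in> (\<Union>\<Theta>)\<^sup>*" for z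
    using that
  proof (induction rule: rtrancl_induct)
    case base show ?case using fx by simp
  next
    case (step y z)
    then obtain \<theta> where t: "\<theta> \<in> \<Theta>" "(y, z) \<in> \<theta>" by blast
    then have "(f y, f z) \<in> \<theta>"
      unfolding f_def using \<Theta>[OF t(1)] c
      by (intro congruence_meet[of \<theta>] congruence_join[of \<theta>] congruence_refl[of \<theta>]) simp_all
    then show ?case using step.IH f[OF congruence_right[OF \<Theta>[OF t(1)] t(2)]] t(1) by auto
  qed
  from this[of J] xJ fJ show "\<exists>\<theta>\<in>\<Theta>. (x, J) \<in> \<theta>" using c by (auto simp: lless_eq trancl_into_rtrancl)
qed (auto intro: r_into_trancl)

end

section \<open>Acyclic reorientations as biclosed sets of arcs\<close>

text \<open>When \<open>A\<close> is a finite strict linear order, these are the inversion sets of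
  permutations.\<close>

definition biclosed :: "('a \<times> 'a) set \<Rightarrow> ('a \<times> 'a) set \<Rightarrow> bool" where
  "biclosed A R \<longleftrightarrow> R \<subseteq> A \<and>
     (\<forall>u w v. (u, w) \<in> A \<longrightarrow> (w, v) \<in> A \<longrightarrow> (u, v) \<in> A \<longrightarrow>
        ((u, w) \<in> R \<longrightarrow> (w, v) \<in> R \<longrightarrow> (u, v) \<in> R) \<and>
        ((u, v) \<in> R \<longrightarrow> (u, w) \<in> R \<or> (w, v) \<in> R))"

lemma biclosed_subset: "biclosed A R \<Longrightarrow> R \<subseteq> A"
  by (simp add: biclosed_def)

lemma biclosed_trans:
  "biclosed A R \<Longrightarrow> (u, w) \<in> R \<Longrightarrow> (w, v) \<in> R \<Longrightarrow> (u, v) \<in> A \<Longrightarrow> (u, v) \<in> R"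
  unfolding biclosed_def by blast

lemma biclosed_split:
  "biclosed A R \<Longrightarrow> (u, v) \<in> R \<Longrightarrow> (u, w) \<in> A \<Longrightarrow> (w, v) \<in> A \<Longrightarrow> (u, w) \<in> R \<or> (w, v) \<in> R"
  unfolding biclosed_def by blast

lemma biclosed_Diff: "biclosed A R \<Longrightarrow> biclosed A (A - R)"
  unfolding biclosed_def by blast

lemma biclosed_converse: "biclosed A R \<Longrightarrow> biclosed (A\<inverse>) (R\<inverse>)"
  unfolding biclosed_def by blast

lemma acyclic_asym: "acyclic A \<Longrightarrow> (x, y) \<in> A \<Longrightarrow> (y, x) \<notin> A"
  by (meson acyclic_def r_into_trancl trancl_trans)

lemma reorientation_reverse_arcs:
  assumes "acyclic A" "R \<subseteq> A"
  shows "reorientation A (reverse_arcs A R)" "A - reverse_arcs A R = R"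
proof -
  note acyclic_asym[OF assms(1)]
  then show "reorientation A (reverse_arcs A R)" "A - reverse_arcs A R = R"
    using assms(2) unfolding reorientation_def reverse_arcs_def by auto
qed

lemma reverse_arcs_reorientation:
  assumes "reorientation A E" shows "reverse_arcs A (A - E) = E"
  using assms unfolding reorientation_def reverse_arcs_def by blast

text \<open>A failure of either condition on a triangle of \<open>A\<close> would make the triangle
  cyclic in \<open>E\<close>. The converse uses that the graph is skeletal, see
  \<open>skeletal_biclosed_acyclic\<close>.\<close>

lemma biclosed_acyclic_reorientation:
  assumes "E \<in> acyclic_reorientations A" shows "biclosed A (A - E)"
proof -
  have E: "E \<union> E\<inverse> = A \<union> A\<inverse>" and ac: "acyclic E"
    using assms by (auto simp: acyclic_reorientations_def reorientation_def)
  have no3: False if "(x, y) \<in> E" "(y, z) \<in> E" "(z, x) \<in> E" for x y z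
    using that ac by (meson acyclic_def r_into_trancl trancl_trans)
  show ?thesis unfolding biclosed_def
  proof (intro conjI allI impI)
    fix u w v assume A: "(u, w) \<in> A" "(w, v) \<in> A" "(u, v) \<in> A"
    show "(u, v) \<in> A - E" if "(u, w) \<in> A - E" "(w, v) \<in> A - E"
      using that A E no3[of u v w] by blast
    show "(u, w) \<in> A - E \<or> (w, v) \<in> A - E" if "(u, v) \<in> A - E"
      using that A E no3[of u w v] by blast
  qed auto
qed

text \<open>
  \<open>contract A w True\<close> projects onto the least elements of the classes of the congruence whose
  contracted ropes have \<open>w\<close> in \<open>Nabla\<close>, and \<open>contract A w False\<close> does so for \<open>\<Delta>\<close>.
\<close>

definition contract :: "('a \<times> 'a) set \<Rightarrow> 'a \<Rightarrow> bool \<Rightarrow> ('a \<times> 'a) set \<Rightarrow> ('a \<times> 'a) set" where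
  "contract A w b R =
     R - {(u, v). (u, w) \<in> A \<and> (w, v) \<in> A \<and> ((u, w) \<in> R \<longleftrightarrow> b) \<and> ((w, v) \<in> R \<longleftrightarrow> \<not> b)}"

lemma contract_subset: "contract A w b R \<subseteq> R"
  by (auto simp: contract_def)

text \<open>Let \<open>b = True\<close> and let \<open>(u, v)\<close> in \<open>R\<close> be removed
  from \<open>S\<close> because of \<open>w\<close>. Then \<open>(w, v)\<close> is outside
  \<open>S\<close>, hence outside \<open>R\<close>, so splitting \<open>(u, v)\<close> puts
  \<open>(u, w)\<close> into \<open>R\<close>, and \<open>(u, v)\<close> is removed from
  \<open>R\<close> as well.\<close>

lemma contract_mono:
  assumes "biclosed A R" "biclosed A S" "R \<subseteq> S"
  shows "contract A w b R \<subseteq> contract A w b S"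
  using assms biclosed_split[OF assms(1)]
  unfolding contract_def by (cases b) blast+

lemma contract_converse: "contract (A\<inverse>) w b (R\<inverse>) = (contract A w (\<not> b) R)\<inverse>"
  by (auto simp: contract_def)

text \<open>These consequences of being skeletal survive the reversal of all arcs, so that for
  \<open>contract\<close> the case \<open>b = False\<close> can be deduced from
  \<open>b = True\<close>.\<close>

locale clique_supports =
  fixes A :: "('a \<times> 'a) set"
  assumes acyc: "acyclic A"
    and support: "(u, w) \<in> A\<^sup>+ \<Longrightarrow> (w, v) \<in> A\<^sup>+ \<Longrightarrow> (u, v) \<in> A \<Longrightarrow> (u, w) \<in> A \<and> (w, v) \<in> A"
    and comparable: "(u, w) \<in> A \<Longrightarrow> (w, v) \<in> A \<Longrightarrow> (u, x) \<in> A \<Longrightarrow> (x, v) \<in> A \<Longrightarrow> (u, v) \<in> A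
      \<Longrightarrow> w = x \<or> (w, x) \<in> A \<or> (x, w) \<in> A"
begin

lemma asym: "(x, y) \<in> A \<Longrightarrow> (y, x) \<notin> A"
  using acyclic_asym[OF acyc] .

lemma irrefl: "(x, x) \<notin> A"
  using asym by blast

text \<open>\<open>A - contract A w (\<not> b) (A - R)\<close> is the dual projection: it adds all
  arcs that meet the removal condition. None of them has \<open>w\<close> as an endpoint, so adding
  or removing them does not affect the condition.\<close>

lemma contract_expand:
  assumes "R \<subseteq> A" shows "contract A w b (A - contract A w (\<not> b) (A - R)) = contract A w b R"
  using assms irrefl by (auto simp: contract_def)

lemma expand_contract:
  assumes "R \<subseteq> A"
  shows "A - contract A w (\<not> b) (A - contract A w b R) = A - contract A w (\<not> b) (A - R)"
  using contract_expand[of "A - R" w "\<not> b"] assms by (simp add: double_diff)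

lemma biclosed_contract_True:
  assumes R: "biclosed A R" shows "biclosed A (contract A w True R)"
  unfolding biclosed_def
proof (intro conjI allI impI)
  note sub = biclosed_subset[OF R]
  let ?C = "contract A w True R"
  show "?C \<subseteq> A" using sub by (auto simp: contract_def)
  have C: "(u, v) \<in> ?C \<longleftrightarrow> (u, v) \<in> R \<and> ((u, w) \<in> R \<longrightarrow> (w, v) \<in> A \<longrightarrow> (w, v) \<in> R)" for u v
    using sub by (auto simp: contract_def)
  fix a b c assume A: "(a, b) \<in> A" "(b, c) \<in> A" "(a, c) \<in> A"
  show "(a, c) \<in> ?C" if ab: "(a, b) \<in> ?C" and bc: "(b, c) \<in> ?C"
  proof (rule ccontr)
    assume "(a, c) \<notin> ?C"
    moreover have ac: "(a, c) \<in> R" using ab bc A biclosed_trans[OF R] by (auto simp: C)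
    ultimately have w: "(a, w) \<in> R" "(w, c) \<in> A" "(w, c) \<notin> R" by (auto simp: C)
    \<comment> \<open>Both \<open>w\<close> and \<open>b\<close> lie in the support of
      \<open>(a, c)\<close>. In each of the three positions, membership of \<open>(a, b)\<close> and
      \<open>(b, c)\<close> in \<open>?C\<close> forces \<open>(w, c)\<close> into
      \<open>R\<close>.\<close>
    then have "w = b \<or> (w, b) \<in> A \<or> (b, w) \<in> A" using comparable[of a w c b] A sub by blast
    then show False
    proof (elim disjE)
      assume "w = b" then show False using w subsetD[OF contract_subset bc] by simp
    next
      assume "(w, b) \<in> A"
      then have "(w, b) \<in> R" using ab w by (auto simp: C)
      then show False using biclosed_trans[OF R, of w b c] w bc by (auto simp: C)
    next
      assume bw: "(b, w) \<in> A"
      then have "(b, w) \<in> R" using biclosed_split[OF R, of b c w] w bc by (auto simp: C)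
      then show False using bc w by (auto simp: C)
    qed
  qed
  show "(a, b) \<in> ?C \<or> (b, c) \<in> ?C" if ac: "(a, c) \<in> ?C"
  proof (rule ccontr)
    assume n: "\<not> ?thesis"
    have "(a, b) \<in> R \<or> (b, c) \<in> R" using ac A biclosed_split[OF R] by (auto simp: C)
    then show False
    proof
      assume "(a, b) \<in> R"
      \<comment> \<open>Here \<open>w\<close> lies between \<open>a\<close> and \<open>b\<close>.
        The arc \<open>(b, c)\<close> turns out to be in \<open>R\<close>, so it too was removed
        because of \<open>w\<close>, which needs an arc \<open>(b, w)\<close> opposite to
        \<open>(w, b)\<close>.\<close>
      then have w: "(a, w) \<in> R" "(w, b) \<in> A" "(w, b) \<notin> R" using n by (auto simp: C)
      have "(w, c) \<in> A" using support[of a w c] w A sub trancl_into_trancl2[of w b A c] by blast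
      then have "(w, c) \<in> R" using w ac by (auto simp: C)
      then have "(b, c) \<in> R" using biclosed_split[OF R, of w c b] w A by blast
      then have "(b, w) \<in> R" using n by (auto simp: C)
      then show False using asym w sub by blast
    next
      assume bc: "(b, c) \<in> R"
      \<comment> \<open>Here \<open>w\<close> lies between \<open>b\<close> and \<open>c\<close>.
        Splitting \<open>(a, c)\<close> at \<open>w\<close> puts \<open>(a, w)\<close> into
        \<open>R\<close>, so \<open>(a, c)\<close> would have been removed.\<close>
      then have w: "(b, w) \<in> R" "(w, c) \<in> A" "(w, c) \<notin> R" using n by (auto simp: C)
      have "(a, w) \<in> A" using support[of a w c] w A sub trancl_into_trancl[of a b A w] by blast
      then show False using biclosed_split[OF R, of a c w] w ac by (auto simp: C)
    qed
  qed
qed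

lemma converse_clique_supports: "clique_supports (A\<inverse>)"
proof
  show "acyclic (A\<inverse>)" using acyc by simp
  show "(u, w) \<in> A\<inverse> \<and> (w, v) \<in> A\<inverse>"
    if "(u, w) \<in> (A\<inverse>)\<^sup>+" "(w, v) \<in> (A\<inverse>)\<^sup>+" "(u, v) \<in> A\<inverse>" for u w v
    using support[of v w u] that by (simp add: trancl_converse)
  show "w = x \<or> (w, x) \<in> A\<inverse> \<or> (x, w) \<in> A\<inverse>"
    if "(u, w) \<in> A\<inverse>" "(w, v) \<in> A\<inverse>" "(u, x) \<in> A\<inverse>" "(x, v) \<in> A\<inverse>" "(u, v) \<in> A\<inverse>" for u w v x
    using comparable[of v w u x] that by auto
qed

end

text \<open>Reversing all arcs exchanges the sides \<open>(u, w)\<close> and \<open>(w, v)\<close>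
  of a triangle, and with them the two values of \<open>b\<close>.\<close>

lemma (in clique_supports) biclosed_contract:
  assumes R: "biclosed A R" shows "biclosed A (contract A w b R)"
proof (cases b)
  case False
  interpret conv: clique_supports "A\<inverse>" by (rule converse_clique_supports)
  have "biclosed (A\<inverse>) (contract (A\<inverse>) w True (R\<inverse>))"
    by (rule conv.biclosed_contract_True[OF biclosed_converse[OF R]])
  then show ?thesis using False biclosed_converse[of "A\<inverse>" "(contract A w False R)\<inverse>"] by (simp add: contract_converse)
qed (simp add: biclosed_contract_True[OF R])

text \<open>
  If a path of \<open>R \<union> S\<close> from \<open>u\<close> to \<open>v\<close> misses \<open>w\<close>, then one of its arcs jumps over \<open>w\<close> in the
  linearly ordered support of \<open>(u, v)\<close>, and is split there.
\<close>

lemma (in clique_supports) biclosed_join: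
  assumes R: "biclosed A R" and S: "biclosed A S"
  shows "biclosed A (A \<inter> (R \<union> S)\<^sup>+)"
  unfolding biclosed_def
proof (intro conjI allI impI)
  let ?T = "R \<union> S"
  have sub: "?T \<subseteq> A" using R S by (simp add: biclosed_subset)
  have subt: "?T\<^sup>+ \<subseteq> A\<^sup>+" using sub by (simp add: trancl_mono_subset)
  fix u w v assume A: "(u, w) \<in> A" "(w, v) \<in> A" "(u, v) \<in> A"
  show "(u, v) \<in> A \<inter> ?T\<^sup>+" if "(u, w) \<in> A \<inter> ?T\<^sup>+" "(w, v) \<in> A \<inter> ?T\<^sup>+"
    using that A by (auto dest: trancl_trans)
  show "(u, w) \<in> A \<inter> ?T\<^sup>+ \<or> (w, v) \<in> A \<inter> ?T\<^sup>+" if uv: "(u, v) \<in> A \<inter> ?T\<^sup>+"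
  proof (rule ccontr)
    assume "\<not> ?thesis"
    then have n: "(u, w) \<notin> ?T\<^sup>+" "(w, v) \<notin> ?T\<^sup>+" using A by auto
    have split: "(x, w) \<in> ?T \<or> (w, y) \<in> ?T" if "(x, y) \<in> ?T" "(x, w) \<in> A" "(w, y) \<in> A" for x y
      using that biclosed_split[OF R] biclosed_split[OF S] by blast
    have "(x, w) \<in> A" if "(u, x) \<in> ?T\<^sup>*" "(x, v) \<in> ?T\<^sup>*" for x
      using that
    proof (induction rule: rtrancl_induct)
      case base show ?case by (rule A)
    next
      case (step x y)
      have xw: "(x, w) \<in> A" using step by (meson converse_rtrancl_into_rtrancl)
      have nx: "(x, w) \<notin> ?T" using n step.hyps(1) by (meson rtrancl_into_trancl1)
      have ny: "(w, y) \<notin> ?T" using n step.prems by (meson rtrancl_into_trancl2)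
      have nwy: "(w, y) \<notin> A" using split[OF step.hyps(2) xw] nx ny by blast
      then have "y \<noteq> v" using A by auto
      then have yv: "(y, v) \<in> ?T\<^sup>+" using step.prems by (simp add: rtrancl_eq_or_trancl)
      have "(u, y) \<in> ?T\<^sup>+" using step.hyps by (rule rtrancl_into_trancl1)
      then have "(u, y) \<in> A" "(y, v) \<in> A" using support[of u y v] yv subt A by blast+
      moreover have "y \<noteq> w" using n yv by auto
      ultimately show ?case using comparable[of u y v w] A nwy by blast
    qed
    from this[of v] have "(v, w) \<in> A" using uv by (simp add: trancl_into_rtrancl)
    then show False using asym A by blast
  qed
qed auto

section \<open>The lattice of acyclic reorientations\<close>

locale skeletal_graph = clique_supports +
  assumes finite: "finite A"
    and biclosed_acyclic: "biclosed A R \<Longrightarrow> acyclic (reverse_arcs A R)"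
begin

lemma finite_AR: "finite (acyclic_reorientations A)"
proof (rule finite_subset)
  show "acyclic_reorientations A \<subseteq> Pow (A \<union> A\<inverse>)"
    by (auto simp: acyclic_reorientations_def reorientation_def)
qed (simp add: finite)

lemma reverse_arcs_AR: "biclosed A R \<Longrightarrow> reverse_arcs A R \<in> acyclic_reorientations A"
  using biclosed_acyclic reorientation_reverse_arcs(1)[OF acyc biclosed_subset]
  by (auto simp: acyclic_reorientations_def)

lemma reversed_reverse_arcs: "biclosed A R \<Longrightarrow> A - reverse_arcs A R = R"
  using reorientation_reverse_arcs(2)[OF acyc biclosed_subset] .

lemma reverse_arcs_reversed: "E \<in> acyclic_reorientations A \<Longrightarrow> reverse_arcs A (A - E) = E"
  by (simp add: acyclic_reorientations_def reverse_arcs_reorientation)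

lemma reversed_inj:
  "E \<in> acyclic_reorientations A \<Longrightarrow> F \<in> acyclic_reorientations A \<Longrightarrow> A - E = A - F \<Longrightarrow> E = F"
  by (metis reverse_arcs_reversed)

lemma AR_simps [simp]:
  "carrier (AR_poset A) = acyclic_reorientations A"
  "le (AR_poset A) E F \<longleftrightarrow> A - E \<subseteq> A - F"
  "eq (AR_poset A) = (=)"
  by (simp_all add: AR_poset_def)

lemma AR_lattice: "lattice (AR_poset A)"
proof unfold_locales
  fix E F assume E: "E \<in> carrier (AR_poset A)" and F: "F \<in> carrier (AR_poset A)"
  have R: "biclosed A (A - E)" "biclosed A (A - F)"
    using E F by (simp_all add: biclosed_acyclic_reorientation)
  show "\<exists>s. least (AR_poset A) s (Upper (AR_poset A) {E, F})"
  proof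
    let ?T = "A \<inter> ((A - E) \<union> (A - F))\<^sup>+"
    have T: "biclosed A ?T" by (rule biclosed_join[OF R])
    have "?T \<subseteq> A - G"
      if "G \<in> acyclic_reorientations A" "A - E \<subseteq> A - G" "A - F \<subseteq> A - G" for G
    proof -
      have G: "biclosed A (A - G)" using that(1) by (rule biclosed_acyclic_reorientation)
      \<comment> \<open>The endpoints of a path need not be adjacent, hence the implication. When
        \<open>(u, z)\<close> is an arc, \<open>support\<close> makes \<open>(u, y)\<close> an arc,
        so the induction hypothesis applies.\<close>
      have "(u, v) \<in> A \<longrightarrow> (u, v) \<in> A - G" if "(u, v) \<in> (A - G)\<^sup>+" for u v
        using that
      proof (induction rule: trancl_induct)
        case (step y z)
        then have "(u, y) \<in> A\<^sup>+" by (meson Diff_subset trancl_mono)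
        then show ?case using support[of u y z] step biclosed_trans[OF G, of u y z] by blast
      qed auto
      moreover have "((A - E) \<union> (A - F))\<^sup>+ \<subseteq> (A - G)\<^sup>+" using that by (intro trancl_mono_subset) blast
      ultimately show ?thesis by auto
    qed
    then show "least (AR_poset A) (reverse_arcs A ?T) (Upper (AR_poset A) {E, F})"
      using E F unfolding least_def Upper_def
      by (auto simp: reverse_arcs_AR[OF T] reversed_reverse_arcs[OF T])
  qed
  show "\<exists>s. greatest (AR_poset A) s (Lower (AR_poset A) {E, F})"
  proof
    \<comment> \<open>The meet is the complement of the join of the complements.\<close>
    let ?T = "A \<inter> ((A - (A - E)) \<union> (A - (A - F)))\<^sup>+"
    have T: "biclosed A (A - ?T)" by (rule biclosed_Diff[OF biclosed_join[OF R[THEN biclosed_Diff]]])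
    have "A - G \<subseteq> A - ?T"
      if "G \<in> acyclic_reorientations A" "A - G \<subseteq> A - E" "A - G \<subseteq> A - F" for G
    proof -
      have G: "biclosed A (A - (A - G))"
        using that(1) by (intro biclosed_Diff biclosed_acyclic_reorientation)
      have "(u, v) \<in> A \<longrightarrow> (u, v) \<in> A - (A - G)" if "(u, v) \<in> (A - (A - G))\<^sup>+" for u v
        using that
      proof (induction rule: trancl_induct)
        case (step y z)
        then have "(u, y) \<in> A\<^sup>+" by (meson Diff_subset trancl_mono)
        then show ?case using support[of u y z] step biclosed_trans[OF G, of u y z] by blast
      qed auto
      moreover have "((A - (A - E)) \<union> (A - (A - F)))\<^sup>+ \<subseteq> (A - (A - G))\<^sup>+"
        using that by (intro trancl_mono_subset) blast
      ultimately show ?thesis using that by auto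
    qed
    then show "greatest (AR_poset A) (reverse_arcs A (A - ?T)) (Lower (AR_poset A) {E, F})"
      using E F unfolding greatest_def Lower_def
      by (auto simp: reverse_arcs_AR[OF T] reversed_reverse_arcs[OF T])
  qed
qed (auto dest: reversed_inj)

definition contract_congruence :: "'a \<Rightarrow> bool \<Rightarrow> (('a \<times> 'a) set \<times> ('a \<times> 'a) set) set" where
  "contract_congruence w b = {(E, F) \<in> acyclic_reorientations A \<times> acyclic_reorientations A.
     contract A w b (A - E) = contract A w b (A - F)}"

lemma lattice_congruence_contract: "lattice_congruence (AR_poset A) (contract_congruence w b)"
proof -
  interpret lattice "AR_poset A" by (rule AR_lattice)
  note bi = biclosed_acyclic_reorientation
  define p where "p E = reverse_arcs A (contract A w b (A - E))" for E
  \<comment> \<open>The dual projection is \<open>contract\<close> for the other value of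
    \<open>b\<close>, conjugated with the complement.\<close>
  define q where "q E = reverse_arcs A (A - contract A w (\<not> b) (A - (A - E)))" for E
  have biq: "biclosed A (A - contract A w (\<not> b) (A - (A - E)))" if "E \<in> acyclic_reorientations A" for E
    using that by (intro biclosed_Diff biclosed_contract bi)
  have p: "p E \<in> acyclic_reorientations A" "A - p E = contract A w b (A - E)"
    if "E \<in> acyclic_reorientations A" for E
    unfolding p_def using biclosed_contract[OF bi[OF that]] reverse_arcs_AR reversed_reverse_arcs by auto
  have q: "q E \<in> acyclic_reorientations A" "A - q E = A - contract A w (\<not> b) (A - (A - E))"
    if "E \<in> acyclic_reorientations A" for E
    unfolding q_def using biq[OF that] reverse_arcs_AR reversed_reverse_arcs by auto
  have "lattice_congruence (AR_poset A)
      {(E, F) \<in> carrier (AR_poset A) \<times> carrier (AR_poset A). p E = p F}"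
  proof (rule kernel_congruence[of p q]; (unfold AR_simps)?)
    fix E F assume E: "E \<in> acyclic_reorientations A"
    show "p E \<in> acyclic_reorientations A" "q E \<in> acyclic_reorientations A" using E p q by blast+
    show "A - p E \<subseteq> A - E" using p(2)[OF E] contract_subset by metis
    show "A - E \<subseteq> A - q E" using q(2)[OF E] contract_subset[of A w "\<not> b" "A - (A - E)"] by blast
    show "p (q E) = p E"
      unfolding p_def using contract_expand[of "A - E" w b] q(2)[OF E] by simp
    show "q (p E) = q E"
      unfolding q_def using expand_contract[of "A - E" w b] p(2)[OF E] by simp
    assume F: "F \<in> acyclic_reorientations A" and le: "A - E \<subseteq> A - F"
    show "A - p E \<subseteq> A - p F"
      using contract_mono[OF bi bi, OF E F le] p(2)[OF E] p(2)[OF F] by simp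
    have "contract A w (\<not> b) (A - (A - F)) \<subseteq> contract A w (\<not> b) (A - (A - E))"
      using le by (intro contract_mono biclosed_Diff bi E F) blast
    then show "A - q E \<subseteq> A - q F" using q(2)[OF E] q(2)[OF F] by auto
  qed
  moreover have "p E = p F \<longleftrightarrow> contract A w b (A - E) = contract A w b (A - F)"
    if "E \<in> acyclic_reorientations A" "F \<in> acyclic_reorientations A" for E F
    using p(2)[OF that(1)] p(2)[OF that(2)] unfolding p_def by metis
  then have "{(E, F) \<in> carrier (AR_poset A) \<times> carrier (AR_poset A). p E = p F} = contract_congruence w b"
    unfolding contract_congruence_def by auto
  ultimately show ?thesis by simp
qed

end

section \<open>Flips\<close>

lemma flip_commute: "flip E u v = flip E v u"
  by (auto simp: flip_def)

text \<open>By reducedness, \<open>E\<close> has no path from \<open>a\<close> to \<open>b\<close>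
  other than the arc itself, so reversing it closes no cycle.\<close>

lemma flip_transitive_reduction:
  assumes E: "acyclic E" and ab: "(a, b) \<in> transitive_reduction E"
  shows "acyclic (flip E a b)" "(b, a) \<in> transitive_reduction (flip E a b)"
proof -
  let ?S = "E - {(a, b)}"
  have abE: "(a, b) \<in> E" and nab: "(a, b) \<notin> E O E\<^sup>+" using ab by (auto simp: transitive_reduction_def)
  have ba: "(b, a) \<notin> E" using acyclic_asym[OF E abE] .
  have flip: "flip E a b = insert (b, a) ?S" using abE ba by (auto simp: flip_def)
  have cyc: "(x, x) \<notin> E\<^sup>+" for x using E by (simp add: acyclic_def)
  have S: "?S\<^sup>+ \<subseteq> E\<^sup>+" "?S\<^sup>* \<subseteq> E\<^sup>*" by (intro trancl_mono_subset rtrancl_mono; blast)+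
  have "(a, b) \<notin> ?S\<^sup>*"
  proof
    assume p: "(a, b) \<in> ?S\<^sup>*"
    have "a \<noteq> b" using abE cyc by auto
    with p obtain c where c: "(a, c) \<in> ?S" "(c, b) \<in> ?S\<^sup>*" by (meson converse_rtranclE)
    then have "(c, b) \<in> ?S\<^sup>+" by (auto simp: rtrancl_eq_or_trancl)
    then show False using c S nab by blast
  qed
  moreover have "acyclic ?S" using E by (rule acyclic_subset) blast
  ultimately show ac: "acyclic (flip E a b)" by (simp add: flip)
  show "(b, a) \<in> transitive_reduction (flip E a b)"
    unfolding transitive_reduction_def
  proof
    show "(b, a) \<in> flip E a b" by (simp add: flip)
    show "(b, a) \<notin> flip E a b O (flip E a b)\<^sup>+"
    proof
      assume "(b, a) \<in> flip E a b O (flip E a b)\<^sup>+"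
      then obtain c where c: "(b, c) \<in> flip E a b" "(c, a) \<in> (flip E a b)\<^sup>+" by blast
      moreover have "c \<noteq> a" using c(2) ac by (auto simp: acyclic_def)
      ultimately have bc: "(b, c) \<in> E" by (auto simp: flip)
      \<comment> \<open>The path from \<open>c\<close> to \<open>a\<close> either avoids the new arc
        \<open>(b, a)\<close> or reaches \<open>b\<close> before using it. Both cases give a cycle
        in \<open>E\<close>.\<close>
      from c(2) consider "(c, a) \<in> ?S\<^sup>+" | "(c, b) \<in> ?S\<^sup>*" unfolding flip trancl_insert by blast
      then show False
      proof cases
        case 1
        then have "(b, a) \<in> E\<^sup>+" using bc S by (blast intro: trancl_into_trancl2)
        then show False using cyc abE by (blast intro: trancl_into_trancl2)
      next
        case 2
        then have "(b, b) \<in> E\<^sup>+" using bc S by (blast intro: rtrancl_into_trancl2)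
        then show False using cyc by blast
      qed
    qed
  qed
qed

text \<open>Among the arcs of \<open>E - F\<close>, one with the fewest vertices between its endpoints works.\<close>

lemma exists_reduced_arc:
  assumes fin: "finite E" and E: "acyclic E" and F: "acyclic F"
    and EF: "E - F \<noteq> {}" and sym: "E \<subseteq> F \<union> F\<inverse>"
  shows "\<exists>a b. (a, b) \<in> E - F \<and> (a, b) \<in> transitive_reduction E"
proof -
  have fin_m: "finite {z. (a, z) \<in> E\<^sup>+ \<and> (z, b) \<in> E\<^sup>+}" for a b
  proof (rule finite_subset)
    show "{z. (a, z) \<in> E\<^sup>+ \<and> (z, b) \<in> E\<^sup>+} \<subseteq> Range (E\<^sup>+)" by blast
  qed (simp add: fin finite_Range)
  define m where "m = (\<lambda>(a, b). card {z. (a, z) \<in> E\<^sup>+ \<and> (z, b) \<in> E\<^sup>+})"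
  have cyc: "(x, x) \<notin> E\<^sup>+" "(x, x) \<notin> F\<^sup>+" for x using E F by (simp_all add: acyclic_def)
  obtain e where "e \<in> E - F" and e_min: "\<And>e'. e' \<in> E - F \<Longrightarrow> m e \<le> m e'"
    using EF ex_has_least_nat[of "\<lambda>e. e \<in> E - F" _ m] by blast
  then obtain a b where e: "e = (a, b)" and ab: "(a, b) \<in> E" "(a, b) \<notin> F" by (cases e) auto
  have "(a, b) \<notin> E O E\<^sup>+"
  proof
    assume "(a, b) \<in> E O E\<^sup>+"
    then obtain c where c: "(a, c) \<in> E" "(c, b) \<in> E\<^sup>+" by blast
    \<comment> \<open>At least one endpoint of \<open>(x, y)\<close> is strictly between
      \<open>a\<close> and \<open>b\<close>, and it is not counted by \<open>m (x, y)\<close>. So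
      \<open>m\<close> is smaller at \<open>(x, y)\<close>, which minimality then puts into
      \<open>F\<close>.\<close>
    have inF: "(x, y) \<in> F"
      if "(x, y) \<in> E" "x = a \<and> (y, b) \<in> E\<^sup>+ \<or> (a, x) \<in> E\<^sup>+ \<and> (y = b \<or> (y, b) \<in> E\<^sup>+)" for x y
    proof (rule ccontr)
      assume "(x, y) \<notin> F"
      then have "m (a, b) \<le> m (x, y)" using e_min[of "(x, y)"] that e by simp
      moreover have "{z. (x, z) \<in> E\<^sup>+ \<and> (z, y) \<in> E\<^sup>+} \<subset> {z. (a, z) \<in> E\<^sup>+ \<and> (z, b) \<in> E\<^sup>+}"
        using that(2)
      proof
        assume xy: "x = a \<and> (y, b) \<in> E\<^sup>+"
        then have "(a, y) \<in> E\<^sup>+" using that(1) by auto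
        moreover have "(z, b) \<in> E\<^sup>+" if "(z, y) \<in> E\<^sup>+" for z using that xy by (meson trancl_trans)
        ultimately show ?thesis using xy cyc(1) by blast
      next
        assume xy: "(a, x) \<in> E\<^sup>+ \<and> (y = b \<or> (y, b) \<in> E\<^sup>+)"
        then have "(x, b) \<in> E\<^sup>+" using that(1) by (auto intro: trancl_into_trancl2)
        moreover have "(a, z) \<in> E\<^sup>+" if "(x, z) \<in> E\<^sup>+" for z using that xy by (meson trancl_trans)
        moreover have "(z, b) \<in> E\<^sup>+" if "(z, y) \<in> E\<^sup>+" for z using that xy by (meson trancl_trans)
        ultimately show ?thesis using xy cyc(1) by blast
      qed
      then have "m (x, y) < m (a, b)" using fin_m unfolding m_def by (simp add: psubset_card_mono)
      ultimately show False by simp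
    qed
    have "(a, z) \<in> E\<^sup>+ \<and> (a, z) \<in> F\<^sup>+" if "(c, z) \<in> E\<^sup>*" "(z, b) \<in> E\<^sup>*" for z
      using that
    proof (induction rule: rtrancl_induct)
      case base then show ?case using inF[of a c] c by blast
    next
      case (step y z)
      then have y: "(a, y) \<in> E\<^sup>+" "(a, y) \<in> F\<^sup>+" by (meson converse_rtrancl_into_rtrancl)+
      then have "(y, z) \<in> F" using inF[of y z] step by (auto simp: rtrancl_eq_or_trancl)
      then show ?case using y step.hyps by (meson trancl_into_trancl)
    qed
    \<comment> \<open>The whole detour through \<open>c\<close> lies in \<open>F\<close> and closes
      a cycle with \<open>(b, a)\<close>.\<close>
    from this[of b] have "(a, b) \<in> F\<^sup>+" using c by (simp add: trancl_into_rtrancl)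
    moreover have "(b, a) \<in> F" using sym ab by blast
    ultimately show False using cyc by (meson trancl_into_trancl)
  qed
  then show ?thesis using ab by (auto simp: transitive_reduction_def)
qed

context skeletal_graph
begin

lemma AR_D:
  assumes "E \<in> acyclic_reorientations A"
  shows "acyclic E" "E \<union> E\<inverse> = A \<union> A\<inverse>" "E \<inter> E\<inverse> = {}" "finite E"
    "(u, v) \<in> A \<Longrightarrow> (u, v) \<in> E \<longleftrightarrow> (v, u) \<notin> E"
proof -
  show E: "acyclic E" "E \<union> E\<inverse> = A \<union> A\<inverse>" "E \<inter> E\<inverse> = {}"
    using assms by (auto simp: acyclic_reorientations_def reorientation_def)
  show "(u, v) \<in> A \<Longrightarrow> (u, v) \<in> E \<longleftrightarrow> (v, u) \<notin> E" using E by blast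
  have "E \<subseteq> A \<union> A\<inverse>" using E by blast
  then show "finite E" using finite by (meson finite_UnI finite_converse finite_subset)
qed

lemma flip_AR:
  assumes E: "E \<in> acyclic_reorientations A" and uv: "(u, v) \<in> A"
    and tr: "(u, v) \<in> transitive_reduction E \<or> (v, u) \<in> transitive_reduction E"
  shows "flip E u v \<in> acyclic_reorientations A"
    and "(u, v) \<in> transitive_reduction (flip E u v) \<or> (v, u) \<in> transitive_reduction (flip E u v)"
    and "flip (flip E u v) u v = E"
proof -
  note D = AR_D[OF E]
  show "(u, v) \<in> transitive_reduction (flip E u v) \<or> (v, u) \<in> transitive_reduction (flip E u v)"
    using tr flip_transitive_reduction(2)[OF D(1)] flip_commute[of E] by metis
  have "acyclic (flip E u v)"
    using tr flip_transitive_reduction(1)[OF D(1)] flip_commute[of E] by metis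
  moreover have "reorientation A (flip E u v)"
    using D(2,3) D(5)[OF uv] uv asym[OF uv] unfolding reorientation_def flip_def by (cases "(u, v) \<in> E") blast+
  ultimately show "flip E u v \<in> acyclic_reorientations A" by (simp add: acyclic_reorientations_def)
  show "flip (flip E u v) u v = E"
    using D(5)[OF uv] unfolding flip_def by (cases "(u, v) \<in> E") auto
qed

lemma reversed_flip:
  assumes "(u, v) \<in> A"
  shows "A - flip E u v = (if (u, v) \<in> E then insert (u, v) (A - E) else (A - E) - {(u, v)})"
  using assms asym[OF assms] by (auto simp: flip_def)

text \<open>The flip changes only \<open>(u, v)\<close>, which the projection removes anyway, and
  leaves the two arcs at \<open>w\<close> that justify the removal.\<close>

lemma contract_congruence_flip:
  assumes E: "E \<in> acyclic_reorientations A" "flip E u v \<in> acyclic_reorientations A"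
    and A: "(u, v) \<in> A" "(u, w) \<in> A" "(w, v) \<in> A"
    and b: "(u, w) \<in> A - E \<longleftrightarrow> b" "(w, v) \<in> A - E \<longleftrightarrow> \<not> b"
  shows "(E, flip E u v) \<in> contract_congruence w b"
proof -
  have "w \<noteq> u" "w \<noteq> v" using A irrefl by auto
  then have "contract A w b (A - E) = contract A w b (A - flip E u v)"
    using A b unfolding contract_def reversed_flip[OF A(1)] by auto
  then show ?thesis using E by (simp add: contract_congruence_def)
qed

section \<open>The coherent congruence as a join of projection kernels\<close>

definition coherent_index :: "'a set \<Rightarrow> 'a set \<Rightarrow> ('a \<times> bool) set" where
  "coherent_index Mho \<Omega> = {(w, b). w \<notin> (if b then Mho else \<Omega>)}"

text \<open>\<open>Id_on\<close> matters when the index set is empty. An index whose vertex lies on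
  no arc contributes only identity pairs.\<close>

definition coherent_join :: "'a set \<Rightarrow> 'a set \<Rightarrow> (('a \<times> 'a) set \<times> ('a \<times> 'a) set) set" where
  "coherent_join Mho \<Omega> = Id_on (acyclic_reorientations A) \<union>
     (\<Union>(case_prod contract_congruence ` coherent_index Mho \<Omega>))\<^sup>+"

lemma coherent_flippable_iff:
  "coherent_flippable A Mho \<Omega> E u v \<longleftrightarrow>
     (u, v) \<in> A \<and> ((u, v) \<in> transitive_reduction E \<or> (v, u) \<in> transitive_reduction E) \<and>
     (\<exists>(w, b) \<in> coherent_index Mho \<Omega>. (u, w) \<in> A \<and> (w, v) \<in> A \<and>
        ((u, w) \<in> A - E \<longleftrightarrow> b) \<and> ((w, v) \<in> A - E \<longleftrightarrow> \<not> b))"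
  unfolding coherent_flippable_def coherent_index_def nabla_set_def delta_set_def
  by (auto simp: ex_bool_eq)

text \<open>Neither the nabla set nor the delta set looks at the arc \<open>(u, v)\<close> itself.
  This makes the flip relation symmetric.\<close>

lemma coherent_flippable_flip:
  assumes "E \<in> acyclic_reorientations A" "coherent_flippable A Mho \<Omega> E u v"
  shows "coherent_flippable A Mho \<Omega> (flip E u v) u v"
proof -
  have uv: "(u, v) \<in> A" and tr: "(u, v) \<in> transitive_reduction E \<or> (v, u) \<in> transitive_reduction E"
    using assms(2) by (auto simp: coherent_flippable_def)
  have "nabla_set A (flip E u v) u v = nabla_set A E u v" "delta_set A (flip E u v) u v = delta_set A E u v"
    using irrefl asym[OF uv] unfolding nabla_set_def delta_set_def flip_def by auto
  then show ?thesis
    using assms flip_AR(2)[OF assms(1) uv tr] by (simp add: coherent_flippable_def)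
qed

lemma sym_coherent_flips: "sym (coherent_flips A Mho \<Omega>)"
proof (rule symI)
  fix E F assume "(E, F) \<in> coherent_flips A Mho \<Omega>"
  then obtain u v where F: "F = flip E u v" and E: "E \<in> acyclic_reorientations A"
    and fl: "coherent_flippable A Mho \<Omega> E u v" by (auto simp: coherent_flips_def)
  have "flip E u v \<in> acyclic_reorientations A" "E = flip (flip E u v) u v"
    using flip_AR[OF E, of u v] fl by (auto simp: coherent_flippable_def)
  then show "(F, E) \<in> coherent_flips A Mho \<Omega>"
    using coherent_flippable_flip[OF E fl] F unfolding coherent_flips_def by blast
qed

lemma coherent_flips_subset:
  "coherent_flips A Mho \<Omega> \<subseteq> \<Union>(case_prod contract_congruence ` coherent_index Mho \<Omega>)"
proof (rule subrelI)
  fix E F assume "(E, F) \<in> coherent_flips A Mho \<Omega>"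
  then obtain u v where F: "F = flip E u v" and E: "E \<in> acyclic_reorientations A"
    and fl: "coherent_flippable A Mho \<Omega> E u v" by (auto simp: coherent_flips_def)
  then obtain w b where "(w, b) \<in> coherent_index Mho \<Omega>" "(u, v) \<in> A" "(u, w) \<in> A" "(w, v) \<in> A"
      "(u, w) \<in> A - E \<longleftrightarrow> b" "(w, v) \<in> A - E \<longleftrightarrow> \<not> b"
    unfolding coherent_flippable_iff by blast
  moreover have "flip E u v \<in> acyclic_reorientations A"
    using flip_AR(1)[OF E, of u v] fl by (auto simp: coherent_flippable_def)
  ultimately have "(E, F) \<in> contract_congruence w b" unfolding F using E by (intro contract_congruence_flip)
  then show "(E, F) \<in> \<Union>(case_prod contract_congruence ` coherent_index Mho \<Omega>)"
    using \<open>(w, b) \<in> coherent_index Mho \<Omega>\<close> by force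
qed

text \<open>Flip a reduced arc of \<open>E\<close> that is not in \<open>F\<close>. The projection
  of \<open>E\<close> does not change, and fewer arcs remain to be turned back.\<close>

lemma coherent_flips_descend:
  assumes wb: "(w, b) \<in> coherent_index Mho \<Omega>" and F: "F \<in> acyclic_reorientations A"
    and "E \<in> acyclic_reorientations A" "A - F \<subseteq> A - E" "contract A w b (A - E) \<subseteq> A - F"
  shows "(E, F) \<in> (coherent_flips A Mho \<Omega>)\<^sup>*"
  using assms(3-)
proof (induction "card ((A - E) - (A - F))" arbitrary: E rule: less_induct)
  case (less E)
  note D = AR_D[OF less.prems(1)] and DF = AR_D[OF F]
  show ?case
  proof (cases "E = F")
    case False
    then have "A - E \<noteq> A - F" using reversed_inj[OF less.prems(1) F] by blast
    then obtain x y where xy: "(x, y) \<in> A" "(x, y) \<notin> E" "(x, y) \<in> F" using less.prems(2) by auto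
    then have "(y, x) \<in> E" "(y, x) \<notin> F" using D(5)[OF xy(1)] DF(5)[OF xy(1)] by auto
    then have ne: "E - F \<noteq> {}" by blast
    have "E \<subseteq> F \<union> F\<inverse>" using D(2) DF(2) by auto
    with exists_reduced_arc[OF D(4,1) DF(1) ne]
    obtain a c where ac: "(a, c) \<in> E" "(a, c) \<notin> F" and tr: "(a, c) \<in> transitive_reduction E" by auto
    \<comment> \<open>Arcs of \<open>A\<close> kept by \<open>E\<close> are kept by
      \<open>F\<close>, so the arc found is a reversed one.\<close>
    have "(a, c) \<notin> A" using ac less.prems(2) by auto
    then have ca: "(c, a) \<in> A" using ac D(2) by auto
    then have ca: "(c, a) \<in> A" "(c, a) \<in> A - E" "(c, a) \<notin> A - F"
      using ac D(5)[OF ca] DF(5)[OF ca] by auto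
    \<comment> \<open>The projection reverses only arcs reversed by \<open>F\<close>, so it removes
      \<open>(c, a)\<close>. The reason for this removal is the witness \<open>w\<close> that makes
      the flip coherent.\<close>
    then have "(c, a) \<notin> contract A w b (A - E)" using less.prems(3) by blast
    then have w: "(c, w) \<in> A" "(w, a) \<in> A" "(c, w) \<in> A - E \<longleftrightarrow> b" "(w, a) \<in> A - E \<longleftrightarrow> \<not> b"
      using ca(2) unfolding contract_def by blast+
    then have fl: "coherent_flippable A Mho \<Omega> E c a"
      using wb ca(1) tr unfolding coherent_flippable_iff by blast
    let ?G = "flip E c a"
    have G: "?G \<in> acyclic_reorientations A" using flip_AR(1)[OF less.prems(1) ca(1)] tr by blast
    have RG: "A - ?G = (A - E) - {(c, a)}" using reversed_flip[OF ca(1)] ca(2) by auto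
    have "contract A w b (A - E) = contract A w b (A - ?G)"
      using contract_congruence_flip[OF less.prems(1) G ca(1) w] by (simp add: contract_congruence_def)
    moreover have "(A - ?G) - (A - F) \<subset> (A - E) - (A - F)" using RG ca by blast
    then have "card ((A - ?G) - (A - F)) < card ((A - E) - (A - F))"
      using finite by (intro psubset_card_mono) auto
    ultimately have "(?G, F) \<in> (coherent_flips A Mho \<Omega>)\<^sup>*"
      using less.hyps[of ?G] G RG less.prems ca by auto
    moreover have "(E, ?G) \<in> coherent_flips A Mho \<Omega>"
      using fl less.prems(1) unfolding coherent_flips_def by blast
    ultimately show ?thesis by (rule converse_rtrancl_into_rtrancl[rotated])
  qed simp
qed

text \<open>Both \<open>E\<close> and \<open>F\<close> descend to their common projection, and flips
  can be undone.\<close>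

lemma contract_congruence_coherent_flips:
  assumes wb: "(w, b) \<in> coherent_index Mho \<Omega>"
  shows "contract_congruence w b \<subseteq> (coherent_flips A Mho \<Omega>)\<^sup>*"
proof (rule subrelI)
  fix E F assume "(E, F) \<in> contract_congruence w b"
  then have E: "E \<in> acyclic_reorientations A" and F: "F \<in> acyclic_reorientations A"
    and eq: "contract A w b (A - E) = contract A w b (A - F)"
    by (auto simp: contract_congruence_def)
  let ?G = "reverse_arcs A (contract A w b (A - E))"
  have bi: "biclosed A (contract A w b (A - E))"
    by (intro biclosed_contract biclosed_acyclic_reorientation E)
  note G = reverse_arcs_AR[OF bi] reversed_reverse_arcs[OF bi]
  have "(E, ?G) \<in> (coherent_flips A Mho \<Omega>)\<^sup>*"
    by (rule coherent_flips_descend[OF wb G(1) E]) (simp_all only: G(2) contract_subset order_refl)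
  moreover have "(F, ?G) \<in> (coherent_flips A Mho \<Omega>)\<^sup>*"
    by (rule coherent_flips_descend[OF wb G(1) F]; unfold G(2); unfold eq) (simp_all only: contract_subset order_refl)
  ultimately show "(E, F) \<in> (coherent_flips A Mho \<Omega>)\<^sup>*"
    using sym_rtrancl[OF sym_coherent_flips] by (meson rtrancl_trans symD)
qed

lemma coherent_join_eq_flips:
  "coherent_join Mho \<Omega> = Id_on (acyclic_reorientations A) \<union> (coherent_flips A Mho \<Omega>)\<^sup>+"
proof -
  let ?U = "\<Union>(case_prod contract_congruence ` coherent_index Mho \<Omega>)"
  have carr: "?U \<subseteq> acyclic_reorientations A \<times> acyclic_reorientations A"
    by (auto simp: contract_congruence_def)
  have "?U \<subseteq> (coherent_flips A Mho \<Omega>)\<^sup>*" using contract_congruence_coherent_flips by blast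
  then have "?U\<^sup>* \<subseteq> (coherent_flips A Mho \<Omega>)\<^sup>*" by (metis rtrancl_mono rtrancl_idemp)
  have "?U\<^sup>+ \<subseteq> Id_on (acyclic_reorientations A) \<union> (coherent_flips A Mho \<Omega>)\<^sup>+"
  proof (rule subrelI)
    fix E F assume EF: "(E, F) \<in> ?U\<^sup>+"
    then have "(E, F) \<in> (coherent_flips A Mho \<Omega>)\<^sup>*"
      using \<open>?U\<^sup>* \<subseteq> _\<close> by (blast intro: trancl_into_rtrancl)
    moreover have "E \<in> acyclic_reorientations A" using EF trancl_subset_Sigma[OF carr] by blast
    ultimately show "(E, F) \<in> Id_on (acyclic_reorientations A) \<union> (coherent_flips A Mho \<Omega>)\<^sup>+"
      by (auto simp: rtrancl_eq_or_trancl)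
  qed
  moreover have "(coherent_flips A Mho \<Omega>)\<^sup>+ \<subseteq> ?U\<^sup>+"
    by (rule trancl_mono_subset[OF coherent_flips_subset])
  ultimately show ?thesis unfolding coherent_join_def by blast
qed

end

section \<open>Ropes\<close>

context skeletal_graph
begin

definition rope_arcs :: "'a rope \<Rightarrow> ('a \<times> 'a) set" where
  "rope_arcs = (\<lambda>(u, v, N, D). {(x, y) \<in> A. x \<in> D \<union> {u} \<and> y \<in> N \<union> {v}})"

lemma I_join_rope_arcs: "I_join A \<rho> = reverse_arcs A (rope_arcs \<rho>)"
  by (cases \<rho>) (simp add: rope_arcs_def)

lemma mem_ropes_iff:
  "(u, v, N, D) \<in> ropes A \<longleftrightarrow>
     (u, v) \<in> A \<and> N \<inter> D = {} \<and> (\<forall>w. w \<in> N \<union> D \<longleftrightarrow> (u, w) \<in> A \<and> (w, v) \<in> A)"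
proof -
  have "w \<in> transitive_support A u v - {u, v} \<longleftrightarrow> (u, w) \<in> A \<and> (w, v) \<in> A" if "(u, v) \<in> A" for w
    using support[of u w v] that irrefl by (auto simp: transitive_support_def rtrancl_eq_or_trancl)
  then show ?thesis unfolding ropes_def by blast
qed

text \<open>No two rope arcs are consecutive, because their sources and targets form disjoint sets.
  A vertex that splits a rope arc \<open>(x, y)\<close> lies in \<open>N\<close> or in
  \<open>D\<close>; the first gives a rope arc from \<open>x\<close>, the second one to
  \<open>y\<close>.\<close>

lemma biclosed_rope_arcs:
  assumes "(u, v, N, D) \<in> ropes A"
  shows "biclosed A (rope_arcs (u, v, N, D))" (is "biclosed A ?R")
    and "biclosed A (rope_arcs (u, v, N, D) - {(u, v)})"
proof -
  have uv: "(u, v) \<in> A" and disj: "N \<inter> D = {}"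
    and ND: "\<And>w. w \<in> N \<or> w \<in> D \<longleftrightarrow> (u, w) \<in> A \<and> (w, v) \<in> A"
    using assms by (auto simp: mem_ropes_iff)
  have R: "(x, y) \<in> ?R \<longleftrightarrow> (x, y) \<in> A \<and> (x = u \<or> x \<in> D) \<and> (y = v \<or> y \<in> N)" for x y
    by (auto simp: rope_arcs_def)
  have notin: "u \<notin> N" "u \<notin> D" "v \<notin> N" "v \<notin> D" "u \<noteq> v" using ND irrefl uv by blast+
  have trans: False if "(x, y) \<in> ?R" "(y, z) \<in> ?R" for x y z
    using that disj notin by (auto simp: R)
  \<comment> \<open>Excluding \<open>(u, v)\<close> here lets the same fact serve both sets.\<close>
  have split: "(x, z) \<in> ?R - {(u, v)} \<or> (z, y) \<in> ?R - {(u, v)}"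
    if "(x, y) \<in> ?R" "(x, z) \<in> A" "(z, y) \<in> A" for x y z
  proof -
    have "(u, z) \<in> A\<^sup>+" "(z, v) \<in> A\<^sup>+"
      using that ND[of x] ND[of y] by (auto simp: R intro: trancl_trans)
    then have z: "(u, z) \<in> A" "(z, v) \<in> A" using support uv by blast+
    then have "z \<noteq> u" "z \<noteq> v" using irrefl by auto
    then show ?thesis using that z ND[of z] by (auto simp: R)
  qed
  have "?R \<subseteq> A" by (auto simp: R)
  then show "biclosed A ?R" "biclosed A (?R - {(u, v)})"
    unfolding biclosed_def using trans split by blast+
qed

text \<open>Split \<open>(u, v)\<close> at \<open>x\<close> to obtain \<open>(x, v)\<close>, then
  split \<open>(x, v)\<close> at \<open>y\<close>. The other halves \<open>(u, x)\<close> and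
  \<open>(y, v)\<close> are not rope arcs.\<close>

lemma rope_arcs_minimal:
  assumes "(u, v, N, D) \<in> ropes A" "biclosed A R" "(u, v) \<in> R" "R \<subseteq> rope_arcs (u, v, N, D)"
  shows "R = rope_arcs (u, v, N, D)"
proof
  have disj: "N \<inter> D = {}" and ND: "\<And>w. w \<in> N \<or> w \<in> D \<longleftrightarrow> (u, w) \<in> A \<and> (w, v) \<in> A"
    using assms(1) by (auto simp: mem_ropes_iff)
  have sub: "x = u \<or> x \<in> D" "y = v \<or> y \<in> N" if "(x, y) \<in> R" for x y
    using that assms(4) by (auto simp: rope_arcs_def)
  have notin: "u \<notin> N" "v \<notin> D" using ND irrefl by blast+
  show "rope_arcs (u, v, N, D) \<subseteq> R"
  proof (rule subrelI)
    fix x y assume "(x, y) \<in> rope_arcs (u, v, N, D)"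
    then have xy: "(x, y) \<in> A" "x = u \<or> x \<in> D" "y = v \<or> y \<in> N" by (auto simp: rope_arcs_def)
    have "(x, v) \<in> R"
    proof (cases "x = u")
      case False
      then have x: "x \<in> D" using xy by simp
      then have "(u, x) \<notin> R" using sub(2)[of u x] notin disj by blast
      then show ?thesis using biclosed_split[OF assms(2,3), of x] x ND[of x] by blast
    qed (simp add: assms(3))
    show "(x, y) \<in> R"
    proof (cases "y = v")
      case False
      then have y: "y \<in> N" using xy by simp
      then have "(y, v) \<notin> R" using sub(1)[of y v] notin disj by blast
      then show ?thesis using biclosed_split[OF assms(2) \<open>(x, v) \<in> R\<close> xy(1)] y ND[of y] by blast
    qed (use \<open>(x, v) \<in> R\<close> in simp)
  qed
qed (rule assms(4))

lemma I_join_irreducible: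
  assumes \<rho>: "(u, v, N, D) \<in> ropes A"
  defines "K \<equiv> reverse_arcs A (rope_arcs (u, v, N, D) - {(u, v)})"
  shows "join_irreducible (AR_poset A) (I_join A (u, v, N, D))"
    and "lower_cover (AR_poset A) (I_join A (u, v, N, D)) = K"
proof -
  interpret lattice "AR_poset A" by (rule AR_lattice)
  let ?R = "rope_arcs (u, v, N, D)" and ?J = "I_join A (u, v, N, D)"
  note bi = biclosed_rope_arcs[OF \<rho>]
  have J: "?J \<in> acyclic_reorientations A" "A - ?J = ?R"
    unfolding I_join_rope_arcs using reverse_arcs_AR reversed_reverse_arcs bi by blast+
  have K: "K \<in> acyclic_reorientations A" "A - K = ?R - {(u, v)}"
    unfolding K_def using reverse_arcs_AR reversed_reverse_arcs bi by blast+
  have "(u, v) \<in> ?R" using \<rho> by (auto simp: mem_ropes_iff rope_arcs_def)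
  then have "A - K \<noteq> A - ?J" unfolding J(2) K(2) by blast
  then have KJ: "K \<sqsubset>\<^bsub>AR_poset A\<^esub> ?J" using J(2) K(2) by (auto simp: lless_eq)
  have below: "E \<sqsubseteq>\<^bsub>AR_poset A\<^esub> K" if E: "E \<in> carrier (AR_poset A)" "E \<sqsubset>\<^bsub>AR_poset A\<^esub> ?J" for E
  proof -
    have E': "E \<in> acyclic_reorientations A" "A - E \<subseteq> ?R" "E \<noteq> ?J" using E J(2) by (auto simp: lless_eq)
    then have "A - E \<noteq> ?R" using reversed_inj[OF E'(1) J(1)] J(2) by auto
    \<comment> \<open>By minimality of the rope arcs, everything strictly below \<open>?J\<close>
      misses \<open>(u, v)\<close>.\<close>
    then have "(u, v) \<notin> A - E"
      using rope_arcs_minimal[OF \<rho> biclosed_acyclic_reorientation[OF E'(1)] _ E'(2)] by blast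
    then show ?thesis using E'(2) unfolding AR_simps K(2) by blast
  qed
  show "join_irreducible (AR_poset A) ?J" "lower_cover (AR_poset A) ?J = K"
    using join_irreducibleI[of K ?J] J(1) K(1) KJ below by simp_all
qed

text \<open>An arc \<open>(u, v)\<close> reversed by \<open>J\<close> but not by its lower cover
  determines a rope. The join irreducible of this rope lies below \<open>J\<close> but not below the
  lower cover, so it equals \<open>J\<close>.\<close>

lemma join_irreducible_rope:
  assumes ji: "join_irreducible (AR_poset A) J"
  shows "\<exists>\<rho>\<in>ropes A. J = I_join A \<rho>"
proof -
  interpret lattice "AR_poset A" by (rule AR_lattice)
  let ?K = "lower_cover (AR_poset A) J"
  have cov: "covers (AR_poset A) J ?K" by (rule join_irreducible_covers[OF ji])
  then have J: "J \<in> acyclic_reorientations A" and K: "?K \<in> acyclic_reorientations A"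
    and KJ: "A - ?K \<subseteq> A - J" "?K \<noteq> J" by (auto simp: covers_def lless_eq)
  note R = biclosed_acyclic_reorientation[OF J]
  have "A - ?K \<noteq> A - J" using reversed_inj[OF K J] KJ(2) by blast
  with KJ(1) obtain u v where uv: "(u, v) \<in> A - J" "(u, v) \<notin> A - ?K" by auto
  define N where "N = {w. (u, w) \<in> A \<and> (w, v) \<in> A \<and> (u, w) \<in> A - J}"
  define D where "D = {w. (u, w) \<in> A \<and> (w, v) \<in> A \<and> (u, w) \<notin> A - J}"
  have \<rho>: "(u, v, N, D) \<in> ropes A" using uv by (auto simp: mem_ropes_iff N_def D_def)
  let ?I = "I_join A (u, v, N, D)"
  note bi = biclosed_rope_arcs(1)[OF \<rho>]
  have I: "?I \<in> acyclic_reorientations A" "A - ?I = rope_arcs (u, v, N, D)"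
    unfolding I_join_rope_arcs using reverse_arcs_AR reversed_reverse_arcs bi by blast+
  have "rope_arcs (u, v, N, D) \<subseteq> A - J"
  proof (rule subrelI)
    fix x y assume "(x, y) \<in> rope_arcs (u, v, N, D)"
    then have xy: "(x, y) \<in> A" "x = u \<or> x \<in> D" "y = v \<or> y \<in> N" by (auto simp: rope_arcs_def)
    \<comment> \<open>For \<open>x\<close> in \<open>D\<close> the arc \<open>(u, x)\<close> is not
      reversed, so splitting \<open>(u, y)\<close> at \<open>x\<close> leaves
      \<open>(x, y)\<close>.\<close>
    have "(u, y) \<in> A - J" using xy(3) uv by (auto simp: N_def)
    then show "(x, y) \<in> A - J"
      using xy biclosed_split[OF R, of u y x] by (auto simp: D_def)
  qed
  moreover have "\<not> ?I \<sqsubset>\<^bsub>AR_poset A\<^esub> J"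
  proof
    assume "?I \<sqsubset>\<^bsub>AR_poset A\<^esub> J"
    then have "?I \<sqsubseteq>\<^bsub>AR_poset A\<^esub> ?K"
      using join_irreducible_lt[OF _ ji, of ?I] I(1) finite_AR by simp
    then have "rope_arcs (u, v, N, D) \<subseteq> A - ?K" unfolding AR_simps I(2) .
    then show False using uv by (auto simp: rope_arcs_def)
  qed
  ultimately have "?I = J" using I(2) by (simp add: lless_eq)
  then show ?thesis using \<rho> by blast
qed

text \<open>The join irreducible and its lower cover differ only in \<open>(u, v)\<close>, so they
  are identified iff the projection removes \<open>(u, v)\<close>.\<close>

lemma contract_congruence_rope:
  assumes \<rho>: "(u, v, N, D) \<in> ropes A"
  shows "(lower_cover (AR_poset A) (I_join A (u, v, N, D)), I_join A (u, v, N, D)) \<in> contract_congruence w b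
     \<longleftrightarrow> w \<in> (if b then N else D)"
proof -
  let ?R = "rope_arcs (u, v, N, D)" and ?J = "I_join A (u, v, N, D)"
  let ?K = "reverse_arcs A (?R - {(u, v)})"
  have uv: "(u, v) \<in> A" and disj: "N \<inter> D = {}"
    and ND: "\<And>w. w \<in> N \<or> w \<in> D \<longleftrightarrow> (u, w) \<in> A \<and> (w, v) \<in> A"
    using \<rho> by (auto simp: mem_ropes_iff)
  note bi = biclosed_rope_arcs[OF \<rho>]
  have J: "?J \<in> acyclic_reorientations A" "A - ?J = ?R"
    unfolding I_join_rope_arcs using reverse_arcs_AR reversed_reverse_arcs bi by blast+
  have K: "?K \<in> acyclic_reorientations A" "A - ?K = ?R - {(u, v)}"
    using reverse_arcs_AR reversed_reverse_arcs bi by blast+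
  have uvR: "(u, v) \<in> ?R" using uv by (auto simp: rope_arcs_def)
  have notin: "u \<notin> N" "v \<notin> D" using ND irrefl by blast+
  have R: "(u, w) \<in> ?R \<longleftrightarrow> w \<in> N" "(w, v) \<in> ?R \<longleftrightarrow> w \<in> D" if "(u, w) \<in> A" "(w, v) \<in> A"
    using that irrefl notin by (auto simp: rope_arcs_def)
  have "contract A w b (?R - {(u, v)}) = contract A w b ?R \<longleftrightarrow> w \<in> (if b then N else D)"
  proof
    assume eq: "contract A w b (?R - {(u, v)}) = contract A w b ?R"
    have "contract A w b (?R - {(u, v)}) \<subseteq> ?R - {(u, v)}" by (rule contract_subset)
    then have "(u, v) \<notin> contract A w b ?R" unfolding eq by auto
    then have "(u, w) \<in> A" "(w, v) \<in> A" "(u, w) \<in> ?R \<longleftrightarrow> b" "(w, v) \<in> ?R \<longleftrightarrow> \<not> b"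
      using uvR by (auto simp: contract_def)
    then show "w \<in> (if b then N else D)" using R by simp
  next
    assume w: "w \<in> (if b then N else D)"
    then have A: "(u, w) \<in> A" "(w, v) \<in> A" using ND by (auto split: if_splits)
    have "(u, w) \<in> ?R \<longleftrightarrow> b" "(w, v) \<in> ?R \<longleftrightarrow> \<not> b" using R[OF A] w disj by (auto split: if_splits)
    moreover have "w \<noteq> u" "w \<noteq> v" using A irrefl by auto
    ultimately show "contract A w b (?R - {(u, v)}) = contract A w b ?R"
      using A uvR unfolding contract_def by auto
  qed
  then show ?thesis
    unfolding I_join_irreducible(2)[OF \<rho>] contract_congruence_def using J K by simp
qed

text \<open>By \<open>covers_Union_congruence\<close>, the join contracts a rope iff a single index
  does, that is, iff a vertex of \<open>N\<close> is outside \<open>Mho\<close> or one of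
  \<open>D\<close> is outside \<open>\<Omega>\<close>.\<close>

lemma uncontracted_coherent_join:
  "uncontracted (AR_poset A) (coherent_join Mho \<Omega>) =
     I_join A ` {(u, v, N, D). (u, v, N, D) \<in> ropes A \<and> N \<subseteq> Mho \<and> D \<subseteq> \<Omega>}"
proof -
  interpret lattice "AR_poset A" by (rule AR_lattice)
  have mem: "I_join A (u, v, N, D) \<in> uncontracted (AR_poset A) (coherent_join Mho \<Omega>)
      \<longleftrightarrow> N \<subseteq> Mho \<and> D \<subseteq> \<Omega>" if \<rho>: "(u, v, N, D) \<in> ropes A" for u v N D
  proof -
    let ?J = "I_join A (u, v, N, D)"
    note ji = I_join_irreducible(1)[OF \<rho>]
    have "(lower_cover (AR_poset A) ?J, ?J) \<in> coherent_join Mho \<Omega> \<longleftrightarrow>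
        (\<exists>\<theta> \<in> case_prod contract_congruence ` coherent_index Mho \<Omega>. (lower_cover (AR_poset A) ?J, ?J) \<in> \<theta>)"
      unfolding coherent_join_def
      by (rule covers_Union_congruence[unfolded AR_simps])
        (use lattice_congruence_contract join_irreducible_covers[OF ji] in auto)
    also have "\<dots> \<longleftrightarrow> (\<exists>i \<in> coherent_index Mho \<Omega>. fst i \<in> (if snd i then N else D))"
      by (simp add: case_prod_unfold contract_congruence_rope[OF \<rho>] del: I_join.simps)
    also have "\<dots> \<longleftrightarrow> \<not> (N \<subseteq> Mho \<and> D \<subseteq> \<Omega>)"
      by (auto simp: coherent_index_def ex_bool_eq Bex_def)
    finally show ?thesis using ji by (simp add: uncontracted_def)
  qed
  show ?thesis
  proof (intro equalityI subsetI)
    fix J assume J: "J \<in> uncontracted (AR_poset A) (coherent_join Mho \<Omega>)"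
    then have "join_irreducible (AR_poset A) J" by (simp add: uncontracted_def)
    then obtain u v N D where "(u, v, N, D) \<in> ropes A" "J = I_join A (u, v, N, D)"
      using join_irreducible_rope by (metis prod_cases4)
    then show "J \<in> I_join A ` {(u, v, N, D). (u, v, N, D) \<in> ropes A \<and> N \<subseteq> Mho \<and> D \<subseteq> \<Omega>}"
      using mem J by blast
  next
    fix J assume "J \<in> I_join A ` {(u, v, N, D). (u, v, N, D) \<in> ropes A \<and> N \<subseteq> Mho \<and> D \<subseteq> \<Omega>}"
    then obtain u v N D where "(u, v, N, D) \<in> ropes A" "J = I_join A (u, v, N, D)" "N \<subseteq> Mho" "D \<subseteq> \<Omega>"
      by blast
    then show "J \<in> uncontracted (AR_poset A) (coherent_join Mho \<Omega>)" using mem by blast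
  qed
qed

lemma lattice_congruence_coherent_join: "lattice_congruence (AR_poset A) (coherent_join Mho \<Omega>)"
proof -
  interpret lattice "AR_poset A" by (rule AR_lattice)
  show ?thesis unfolding coherent_join_def
    by (rule congruence_Union[unfolded AR_simps]) (use lattice_congruence_contract in auto)
qed

lemma coherent_congruence_eq_join: "coherent_congruence A Mho \<Omega> = coherent_join Mho \<Omega>"
proof -
  interpret lattice "AR_poset A" by (rule AR_lattice)
  show ?thesis unfolding coherent_congruence_def
  proof (rule the_equality)
    fix \<theta> assume "lattice_congruence (AR_poset A) \<theta> \<and> uncontracted (AR_poset A) \<theta> =
      I_join A ` {(u, v, N, D). (u, v, N, D) \<in> ropes A \<and> N \<subseteq> Mho \<and> D \<subseteq> \<Omega>}"
    \<comment> \<open>The uniqueness required by \<open>THE\<close>: uncontracted join irreducibles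
      determine a congruence.\<close>
    then show "\<theta> = coherent_join Mho \<Omega>"
      by (intro congruence_eq_of_uncontracted)
        (simp_all add: finite_AR lattice_congruence_coherent_join uncontracted_coherent_join)
  qed (simp add: lattice_congruence_coherent_join uncontracted_coherent_join)
qed

end

section \<open>Skeletal graphs\<close>

lemma trancl_path:
  "(u, v) \<in> A\<^sup>+ \<Longrightarrow> \<exists>xs. successively (\<lambda>x y. (x, y) \<in> A) (u # xs @ [v])"
proof (induction rule: converse_trancl_induct)
  case (base y)
  then have "successively (\<lambda>x y. (x, y) \<in> A) (y # [] @ [v])" by simp
  then show ?case by blast
next
  case (step y z)
  then obtain xs where "successively (\<lambda>x y. (x, y) \<in> A) (z # xs @ [v])" by blast
  with step.hyps(1) have "successively (\<lambda>x y. (x, y) \<in> A) (y # (z # xs) @ [v])" by simp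
  then show ?case by blast
qed

text \<open>Apply filledness to the concatenation of a path from \<open>u\<close> to
  \<open>w\<close> with one from \<open>w\<close> to \<open>v\<close>.\<close>

lemma filled_support:
  assumes "filled A" "(u, w) \<in> A\<^sup>+" "(w, v) \<in> A\<^sup>+" "(u, v) \<in> A"
  shows "(u, w) \<in> A \<and> (w, v) \<in> A"
proof -
  obtain xs ys where "successively (\<lambda>x y. (x, y) \<in> A) ((u # xs) @ [w])"
      "successively (\<lambda>x y. (x, y) \<in> A) (w # ys @ [v])"
    using trancl_path[OF assms(2)] trancl_path[OF assms(3)] by auto
  then have "successively (\<lambda>x y. (x, y) \<in> A) ((u # xs) @ (w # ys @ [v]))"
    unfolding successively_append_iff[of _ "u # xs"] by simp
  moreover have "(hd ((u # xs) @ (w # ys @ [v])), last ((u # xs) @ (w # ys @ [v]))) \<in> A"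
    using assms(4) by simp
  ultimately have "sorted_wrt (\<lambda>x y. (x, y) \<in> A) ((u # xs) @ (w # ys @ [v]))"
    using assms(1) unfolding filled_def by blast
  then show ?thesis by (simp add: sorted_wrt_append)
qed

text \<open>Filledness shortens a path that bypasses \<open>(a, b)\<close> to two arcs through its
  first inner vertex.\<close>

lemma not_reduced_triangle:
  assumes "filled A" "(a, b) \<in> A" "a \<in> X" "b \<in> X" "(a, b) \<notin> transitive_reduction (A \<inter> X \<times> X)"
  shows "\<exists>z\<in>X. (a, z) \<in> A \<and> (z, b) \<in> A"
proof -
  obtain z where z: "(a, z) \<in> A \<inter> X \<times> X" "(z, b) \<in> (A \<inter> X \<times> X)\<^sup>+"
    using assms by (auto simp: transitive_reduction_def)
  have "(z, b) \<in> A\<^sup>+" using z(2) by (rule trancl_mono) blast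
  then show ?thesis using filled_support[OF assms(1) _ _ assms(2), of z] z(1) by blast
qed

lemma vertebrate_not_cycle:
  assumes "vertebrate V A" "X \<subseteq> V" "3 \<le> length xs" "distinct xs"
    and "successively (\<lambda>x y. (x, y) \<in> T \<union> T\<inverse>) xs" "(last xs, hd xs) \<in> T \<union> T\<inverse>"
    and "T = transitive_reduction (A \<inter> X \<times> X)"
  shows False
  using assms by (auto simp: vertebrate_def forest_def undirected_cycle_def)

text \<open>Otherwise the support contains a diamond, whose transitive reduction is a 4-cycle.\<close>

lemma skeletal_comparable:
  assumes dag: "dag V A" and sk: "skeletal V A"
    and A: "(u, w) \<in> A" "(w, v) \<in> A" "(u, x) \<in> A" "(x, v) \<in> A" "(u, v) \<in> A"
  shows "w = x \<or> (w, x) \<in> A \<or> (x, w) \<in> A"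
proof (rule ccontr)
  assume n: "\<not> ?thesis"
  have acyc: "acyclic A" and sub: "A \<subseteq> V \<times> V" using dag by (auto simp: dag_def)
  have filled: "filled A" and vert: "vertebrate V A" using sk by (auto simp: skeletal_def)
  note as = acyclic_asym[OF acyc]
  let ?X = "{u, w, v, x}"
  let ?T = "transitive_reduction (A \<inter> ?X \<times> ?X)"
  note tri = not_reduced_triangle[OF filled, of _ _ ?X]
  have "(u, w) \<in> ?T" using tri[of u w] A n as by auto
  moreover have "(w, v) \<in> ?T" using tri[of w v] A n as by auto
  moreover have "(u, x) \<in> ?T" using tri[of u x] A n as by auto
  moreover have "(x, v) \<in> ?T" using tri[of x v] A n as by auto
  moreover have "distinct [u, w, v, x]" using A n as by auto
  moreover have "?X \<subseteq> V" using A sub by auto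
  ultimately show False using vertebrate_not_cycle[OF vert, of ?X "[u, w, v, x]" ?T] by simp
qed

text \<open>
  A shortest directed cycle of the reorientation is chordless. If its length is at least 4, then
  all its arcs are in the transitive reduction of the subgraph that it induces.
\<close>

lemma skeletal_biclosed_acyclic:
  assumes dag: "dag V A" and sk: "skeletal V A" and R: "biclosed A R"
  shows "acyclic (reverse_arcs A R)"
proof (rule ccontr)
  define E where "E = reverse_arcs A R"
  assume "\<not> acyclic (reverse_arcs A R)"
  then obtain y where "(y, y) \<in> E\<^sup>+" by (auto simp: acyclic_def E_def)
  then obtain m where m: "m > 0" "(y, y) \<in> E ^^ m" by (auto simp: trancl_power)
  have acyc: "acyclic A" and subV: "A \<subseteq> V \<times> V" using dag by (auto simp: dag_def)
  have filled: "filled A" and vert: "vertebrate V A" using sk by (auto simp: skeletal_def)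
  have sub: "R \<subseteq> A" using R by (rule biclosed_subset)
  have EA: "E \<union> E\<inverse> = A \<union> A\<inverse>" and EE: "\<And>x y. (x, y) \<in> E \<Longrightarrow> (y, x) \<notin> E"
    using reorientation_reverse_arcs(1)[OF acyc sub] by (auto simp: E_def reorientation_def)
  have memE: "(x, y) \<in> E \<longleftrightarrow> (x, y) \<in> A \<and> (x, y) \<notin> R \<or> (y, x) \<in> A \<and> (y, x) \<in> R" for x y
    using sub by (auto simp: E_def reverse_arcs_def)
  have cyc3: "False" if "(x, y) \<in> A" "(y, z) \<in> A" "(z, x) \<in> A" for x y z
    using that acyc by (meson acyclic_def r_into_trancl trancl_trans)
  \<comment> \<open>\<open>A\<close> has no cyclic triangle, so a cyclic triangle of
    \<open>E\<close> would violate closure or splitting.\<close>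
  have no3: "False" if "(x, y) \<in> E" "(y, z) \<in> E" "(z, x) \<in> E" for x y z
    using that cyc3[of x y z] cyc3[of x z y]
      biclosed_trans[OF R, of x y z] biclosed_trans[OF R, of y z x] biclosed_trans[OF R, of z x y]
      biclosed_trans[OF R, of z y x] biclosed_trans[OF R, of y x z] biclosed_trans[OF R, of x z y]
      biclosed_split[OF R, of x z y] biclosed_split[OF R, of y x z] biclosed_split[OF R, of z y x]
      biclosed_split[OF R, of x y z] biclosed_split[OF R, of y z x] biclosed_split[OF R, of z x y]
    unfolding memE by argo
  define n where "n = (LEAST n. n > 0 \<and> (\<exists>x. (x, x) \<in> E ^^ n))"
  have "n > 0 \<and> (\<exists>x. (x, x) \<in> E ^^ n)"
    unfolding n_def by (rule LeastI[of "\<lambda>n. n > 0 \<and> (\<exists>x. (x, x) \<in> E ^^ n)" m]) (use m in blast)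
  then obtain x where n: "n > 0" "(x, x) \<in> E ^^ n" by blast
  have least: "n \<le> k" if "k > 0" "(z, z) \<in> E ^^ k" for k z
    unfolding n_def by (rule Least_le) (use that in blast)
  obtain f where f: "f 0 = x" "f n = x" and step: "\<And>i. i < n \<Longrightarrow> (f i, f (Suc i)) \<in> E"
    using n(2) unfolding relpow_fun_conv by blast
  have seg: "(f i, f (i + k)) \<in> E ^^ k" if "i + k \<le> n" for i k
    using that
  proof (induction k)
    case (Suc k)
    then show ?case using relpow_Suc_I[OF _ step[of "i + k"]] by simp
  qed simp
  \<comment> \<open>A forward chord shortcuts the cycle to length \<open>Suc i + (n - j)\<close>,
    which must be at least \<open>n\<close>.\<close>
  have chord: "j = Suc i" if "(f i, f j) \<in> E" "i < j" "j < n" for i j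
  proof -
    have "(f 0, f i) \<in> E ^^ i" using seg[of 0 i] that by simp
    moreover have "(f j, f n) \<in> E ^^ (n - j)" using seg[of j "n - j"] that by simp
    ultimately have "(x, x) \<in> E ^^ (Suc i + (n - j))"
      using that f unfolding relpow_add by (auto intro: relpow_Suc_I)
    then show ?thesis using least[of "Suc i + (n - j)" x] that by simp
  qed
  \<comment> \<open>A backward chord closes the segment from \<open>i\<close> to \<open>j\<close>
    into a cycle of length \<open>Suc (j - i)\<close>, which reaches \<open>n\<close> only for the
    whole cycle.\<close>
  have backward: "i = 0 \<and> j = n - 1" if "(f j, f i) \<in> E" "i < j" "j < n" for i j
  proof -
    have "(f i, f j) \<in> E ^^ (j - i)" using seg[of i "j - i"] that by simp
    then have "(f i, f i) \<in> E ^^ Suc (j - i)" using that by (auto intro: relpow_Suc_I)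
    then show ?thesis using least[of "Suc (j - i)" "f i"] that by auto
  qed
  have inj: "f i \<noteq> f j" if "i < j" "j < n" for i j
    using seg[of i "j - i"] least[of "j - i" "f i"] that by auto
  have adj: "j = Suc i \<or> i = Suc j \<or> i = 0 \<and> j = n - 1 \<or> j = 0 \<and> i = n - 1"
    if "(f i, f j) \<in> A \<or> (f j, f i) \<in> A" "i < n" "j < n" for i j
  proof -
    have "(f i, f j) \<in> E \<or> (f j, f i) \<in> E" using that(1) EA by blast
    moreover have "i \<noteq> j" using calculation EE by auto
    ultimately show ?thesis using chord[of i j] chord[of j i] backward[of i j] backward[of j i] that(2,3)
      by (meson linorder_neqE_nat)
  qed
  have "n \<noteq> 1" using step[of 0] f EE[of x x] by auto
  moreover have "n \<noteq> 2" using step[of 0] step[of 1] f EE[of x "f 1"] by (auto simp: numeral_2_eq_2)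
  moreover have "n \<noteq> 3" using step[of 0] step[of 1] step[of 2] f no3[of "f 0" "f 1" "f 2"]
    by (auto simp: numeral_eq_Suc)
  ultimately have n4: "n \<ge> 4" using n(1) by linarith
  let ?X = "f ` {..<n}"
  let ?T = "transitive_reduction (A \<inter> ?X \<times> ?X)"
  have X: "f i \<in> ?X" if "i \<le> n" for i using that f n(1) by (cases "i = n") (auto intro: image_eqI[of _ _ 0])
  \<comment> \<open>A chordless cycle of length at least 4 has no three pairwise adjacent vertices,
    so no arc of the induced subgraph is bypassed.\<close>
  have no_tri: False if xyz: "(a, b) \<in> A" "(a, z) \<in> A" "(z, b) \<in> A" "a \<in> ?X" "b \<in> ?X" "z \<in> ?X" for a b z
  proof -
    obtain i j k where ijk: "a = f i" "b = f j" "z = f k" "i < n" "j < n" "k < n" using xyz by auto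
    have "i \<noteq> j" "i \<noteq> k" "k \<noteq> j" using xyz ijk acyclic_asym[OF acyc] by auto
    then show False using adj[of i j] adj[of i k] adj[of k j] xyz ijk n4 by simp linarith
  qed
  have arc: "(a, b) \<in> ?T" if "(a, b) \<in> A" "a \<in> ?X" "b \<in> ?X" for a b
    using not_reduced_triangle[OF filled that] no_tri that by blast
  have edge: "(f i, f (Suc i)) \<in> ?T \<union> ?T\<inverse>" if "i < n" for i
    using step[OF that] arc X[of i] X[of "Suc i"] that memE by auto
  let ?xs = "map f [0..<n]"
  have "distinct ?xs" using inj by (auto simp: distinct_map inj_on_def) (metis linorder_neqE_nat)
  moreover have "successively (\<lambda>x y. (x, y) \<in> ?T \<union> ?T\<inverse>) ?xs"
    unfolding successively_conv_nth using edge by simp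
  moreover have "(last ?xs, hd ?xs) \<in> ?T \<union> ?T\<inverse>"
    using edge[of "n - 1"] n(1) f by (simp add: last_map hd_map)
  moreover have "?X \<subseteq> V"
  proof
    fix z assume "z \<in> ?X"
    then obtain i where "z = f i" "i < n" by auto
    then show "z \<in> V" using step[of i] memE subV by blast
  qed
  ultimately show False using vertebrate_not_cycle[OF vert, of ?X ?xs ?T] n4 by simp
qed

lemma skeletal_graph_if_skeletal:
  assumes "dag V A" "skeletal V A" shows "skeletal_graph A"
proof
  show "acyclic A" using assms by (simp add: dag_def)
  show "finite A" using assms finite_subset[of A "V \<times> V"] by (simp add: dag_def)
  show "(u, w) \<in> A \<and> (w, v) \<in> A" if "(u, w) \<in> A\<^sup>+" "(w, v) \<in> A\<^sup>+" "(u, v) \<in> A" for u w v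
    using filled_support[OF _ that] assms by (simp add: skeletal_def)
  show "w = x \<or> (w, x) \<in> A \<or> (x, w) \<in> A"
    if "(u, w) \<in> A" "(w, v) \<in> A" "(u, x) \<in> A" "(x, v) \<in> A" "(u, v) \<in> A" for u w v x
    using skeletal_comparable assms that by metis
  show "acyclic (reverse_arcs A R)" if "biclosed A R" for R
    using skeletal_biclosed_acyclic assms that by metis
qed

theorem proposition47:
  fixes V :: "'a set" and A :: "('a \<times> 'a) set" and Mho \<Omega> :: "'a set"
  assumes "dag V A" and "skeletal V A" and "Mho \<subseteq> V" and "\<Omega> \<subseteq> V"
  shows "(\<forall>E \<in> acyclic_reorientations A. \<forall>u v. coherent_flippable A Mho \<Omega> E u v \<longrightarrow>
            flip E u v \<in> acyclic_reorientations A \<and>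
            coherent_congruence A Mho \<Omega> `` {flip E u v} = coherent_congruence A Mho \<Omega> `` {E})
       \<and> coherent_congruence A Mho \<Omega> =
           Id_on (acyclic_reorientations A) \<union> (coherent_flips A Mho \<Omega>)\<^sup>+"
proof -
  interpret skeletal_graph A by (rule skeletal_graph_if_skeletal[OF assms(1,2)])
  let ?C = "coherent_congruence A Mho \<Omega>"
  have C: "?C = Id_on (acyclic_reorientations A) \<union> (coherent_flips A Mho \<Omega>)\<^sup>+"
    unfolding coherent_congruence_eq_join by (rule coherent_join_eq_flips)
  have equiv: "equiv (acyclic_reorientations A) ?C"
    using lattice_congruence_coherent_join[of Mho \<Omega>]
    unfolding coherent_congruence_eq_join lattice_congruence_def by simp
  have "flip E u v \<in> acyclic_reorientations A \<and> ?C `` {flip E u v} = ?C `` {E}"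
    if E: "E \<in> acyclic_reorientations A" and fl: "coherent_flippable A Mho \<Omega> E u v" for E u v
  proof
    show "flip E u v \<in> acyclic_reorientations A"
      using flip_AR(1)[OF E] fl by (simp add: coherent_flippable_def)
    have "(E, flip E u v) \<in> coherent_flips A Mho \<Omega>" using E fl unfolding coherent_flips_def by blast
    then have "(E, flip E u v) \<in> ?C" unfolding C by blast
    then show "?C `` {flip E u v} = ?C `` {E}" using equiv_class_eq[OF equiv] by simp
  qed
  with C show ?thesis by blast
qed

end
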